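(* Let $m=2k+1\ge 3$ be an odd integer and $q=2^m=2^{2k+1}$. Let $\mathcal{F}$ be an algebraic closure of $\mathbf{F}_2$ and let $\rho:\mathbf{Sz}(q)\to\mathrm{Aut}(V)$ be an absolutely irreducible faithful representation of the Suzuki group $\mathbf{Sz}(q)$ over $\mathcal{F}$. If the trace map $\mathrm{tr}_\rho:\mathbf{Sz}(q)\to\mathcal{F}$, $g\mapsto\mathrm{tr}(\rho(g))$, takes on values in $\mathbf{F}_2$, then $\dim_{\mathcal{F}}(V)=q^2$. In particular, $\rho$ is (isomorphic to) the Steinberg representation of $\mathbf{Sz}(q)$.
   Context: The Suzuki group $\mathbf{Sz}(q)$ is the subgroup of $\mathrm{GL}_4(\mathbf{F}_q)$ generated by the matrices $S(a,b)$ ($a,b\in\mathbf{F}_q$), $M(\lambda)$ ($\lambda\in\mathbf{F}_q^*$) and $T$, where $$S(a,b)=\begin{pmatrix}1&0&0&0\\ a&1&0&0\\ b&a^{2^{k+1}}&1&0\\ a^{2^{k+1}+2}+ab+b^{2^{k+1}}&a^{2^{k+1}+1}+b&a&1\end{pmatrix},$$ $$M(\lambda)=\begin{pmatrix}\lambda^{1+2^k}&0&0&0\\0&\lambda^{2^k}&0&0\\0&0&\lambda^{-2^k}&0\\0&0&0&\lambda^{-1-2^k}\end{pmatrix},\qquad T=\begin{pmatrix}0&0&0&1\\0&0&1&0\\0&1&0&0\\1&0&0&0\end{pmatrix}.$$ Its order is $(q^2+1)q^2(q-1)$. The Steinberg representation of $\mathbf{Sz}(q)$ over $\mathcal{F}$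 is the irreducible representation (unique up to isomorphism) of dimension equal to the largest power of $2$ dividing $\#(\mathbf{Sz}(q))$, that is, of dimension $q^2$; concretely it is the space of functions $h:\mathbf{Sz}(q)/P\to\mathcal{F}$ with $\sum_x h(x)=0$, with the natural action of $\mathbf{Sz}(q)$, where $P$ is the subgroup (of index $q^2+1$) generated by all $S(a,b)$ and $M(\lambda)$. *)

theory Defs
  imports
    "HOL-Analysis.Determinants"
    "HOL-Algebra.Left_Coset"
    "HOL-Algebra.Generated_Groups"
    "HOL-Algebra.Algebraic_Closure_Type"
    "HOL-Library.Function_Algebras"
begin

section \<open>The Suzuki groups\<close>

definition GL4 :: "('q::field^4^4) monoid" where
  "GL4 = \<lparr>carrier = {A. invertible A}, monoid.mult = (\<lambda>A B. A ** B), one = mat 1\<rparr>"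

text \<open>Throughout, \<open>k\<close> is the parameter with \<open>CARD('q) = 2 ^ (2 * k + 1)\<close>. The index type \<open>4\<close>
  has elements \<open>1, 2, 3, 4 = 0\<close>, and \<^const>\<open>vector\<close> fills the positions in this order.\<close>

definition suzuki_S :: "nat \<Rightarrow> 'q \<Rightarrow> 'q \<Rightarrow> 'q::field^4^4" where
  "suzuki_S k a b = vector
    [vector [1, 0, 0, 0],
     vector [a, 1, 0, 0],
     vector [b, a ^ (2 ^ (k+1)), 1, 0],
     vector [a ^ (2 ^ (k+1) + 2) + a * b + b ^ (2 ^ (k+1)), a ^ (2 ^ (k+1) + 1) + b, a, 1]]"

definition suzuki_M :: "nat \<Rightarrow> 'q \<Rightarrow> 'q::field^4^4" where
  "suzuki_M k l = vector
    [vector [l ^ (1 + 2 ^ k), 0, 0, 0],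
     vector [0, l ^ (2 ^ k), 0, 0],
     vector [0, 0, inverse (l ^ (2 ^ k)), 0],
     vector [0, 0, 0, inverse (l ^ (1 + 2 ^ k))]]"

definition suzuki_T :: "'q::field^4^4" where
  "suzuki_T = vector
    [vector [0, 0, 0, 1],
     vector [0, 0, 1, 0],
     vector [0, 1, 0, 0],
     vector [1, 0, 0, 0]]"

definition suzuki_group :: "nat \<Rightarrow> ('q::field^4^4) monoid" where
  "suzuki_group k = GL4\<lparr>carrier := generate GL4
     ({suzuki_S k a b | a b. True} \<union> {suzuki_M k l | l. l \<noteq> 0} \<union> {suzuki_T})\<rparr>"

definition suzuki_P :: "nat \<Rightarrow> ('q::field^4^4) set" where
  "suzuki_P k = generate GL4
     ({suzuki_S k a b | a b. True} \<union> {suzuki_M k l | l. l \<noteq> 0})"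


section \<open>Representations\<close>

text \<open>A field of class \<^class>\<open>alg_closed_field\<close> is an algebraic closure of the field with two
  elements iff it has characteristic two and each element is a root of a nonzero polynomial with
  coefficients in the prime field \<open>{0, 1}\<close>.\<close>

definition algebraic_closure_of_F2 :: "'f::alg_closed_field itself \<Rightarrow> bool" where
  "algebraic_closure_of_F2 _ \<longleftrightarrow>
     CHAR('f) = 2 \<and>
     (\<forall>x::'f. \<exists>p. p \<noteq> 0 \<and> range (poly.coeff p) \<subseteq> {0, 1} \<and> poly p x = 0)"

definition Aut :: "('f::field \<Rightarrow> 'v::ab_group_add \<Rightarrow> 'v) \<Rightarrow> ('v \<Rightarrow> 'v) monoid" where
  "Aut sc = \<lparr>carrier = {f. Vector_Spaces.linear sc sc f \<and> bij f},
                monoid.mult = (\<lambda>f g. f \<circ> g), one = id\<rparr>"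

definition linear_trace ::
    "('f::field \<Rightarrow> 'v::ab_group_add \<Rightarrow> 'v) \<Rightarrow> 'v set \<Rightarrow> ('v \<Rightarrow> 'v) \<Rightarrow> 'f" where
  "linear_trace sc B f = (\<Sum>b\<in>B. module.representation sc B (f b) b)"

text \<open>Here \<open>\<rho>\<close> is a representation of \<open>G\<close> on a subspace \<open>U\<close> of the type \<open>'v\<close>.\<close>

definition irreducible_rep ::
    "('g, 'm) monoid_scheme \<Rightarrow> ('f::field \<Rightarrow> 'v::ab_group_add \<Rightarrow> 'v) \<Rightarrow> 'v set
       \<Rightarrow> ('g \<Rightarrow> 'v \<Rightarrow> 'v) \<Rightarrow> bool" where
  "irreducible_rep G sc U \<rho> \<longleftrightarrow>
     U \<noteq> {0} \<and>
     (\<forall>W. module.subspace sc W \<and> W \<subseteq> U \<and> (\<forall>g\<in>carrier G. \<rho> g ` W \<subseteq> W)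
        \<longrightarrow> W = {0} \<or> W = U)"

definition isomorphic_reps ::
    "('g, 'm) monoid_scheme
       \<Rightarrow> ('f::field \<Rightarrow> 'v::ab_group_add \<Rightarrow> 'v) \<Rightarrow> 'v set \<Rightarrow> ('g \<Rightarrow> 'v \<Rightarrow> 'v)
       \<Rightarrow> ('f \<Rightarrow> 'w::ab_group_add \<Rightarrow> 'w) \<Rightarrow> 'w set \<Rightarrow> ('g \<Rightarrow> 'w \<Rightarrow> 'w) \<Rightarrow> bool" where
  "isomorphic_reps G s1 U1 \<rho>1 s2 U2 \<rho>2 \<longleftrightarrow>
     (\<exists>\<phi>. bij_betw \<phi> U1 U2 \<and>
        (\<forall>x\<in>U1. \<forall>y\<in>U1. \<phi> (x + y) = \<phi> x + \<phi> y) \<and>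
        (\<forall>c. \<forall>x\<in>U1. \<phi> (s1 c x) = s2 c (\<phi> x)) \<and>
        (\<forall>g\<in>carrier G. \<forall>x\<in>U1. \<phi> (\<rho>1 g x) = \<rho>2 g (\<phi> x)))"

definition fun_scale :: "'f::field \<Rightarrow> ('x \<Rightarrow> 'f) \<Rightarrow> 'x \<Rightarrow> 'f" where
  "fun_scale c h = (\<lambda>x. c * h x)"

text \<open>Absolute irreducibility is irreducibility after extension of scalars to an algebraic closure.
  The vector space \<open>V \<otimes> 'f alg_closure\<close> is written in the coordinates given by the basis of
  \<open>V\<close>: its elements are the coordinate functions \<open>x\<close> supported on the basis, standing for
  the sum of the \<open>b \<otimes> x b\<close>, and \<open>g\<close> acts through the matrix of \<open>\<rho> g\<close>.\<close>

definition ext_space :: "'v set \<Rightarrow> ('v \<Rightarrow> 'f::field alg_closure) set" where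
  "ext_space B = {x. \<forall>b. b \<notin> B \<longrightarrow> x b = 0}"

definition ext_action ::
    "('f::field \<Rightarrow> 'v::ab_group_add \<Rightarrow> 'v) \<Rightarrow> 'v set \<Rightarrow> ('g \<Rightarrow> 'v \<Rightarrow> 'v)
       \<Rightarrow> 'g \<Rightarrow> ('v \<Rightarrow> 'f alg_closure) \<Rightarrow> 'v \<Rightarrow> 'f alg_closure" where
  "ext_action sc B \<rho> g x =
     (\<lambda>c. \<Sum>b\<in>B. to_ac (module.representation sc B (\<rho> g b) c) * x b)"

definition absolutely_irreducible_rep ::
    "('g, 'm) monoid_scheme \<Rightarrow> ('f::field \<Rightarrow> 'v::ab_group_add \<Rightarrow> 'v) \<Rightarrow> 'v set
       \<Rightarrow> ('g \<Rightarrow> 'v \<Rightarrow> 'v) \<Rightarrow> bool" where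
  "absolutely_irreducible_rep G sc B \<rho> \<longleftrightarrow>
     irreducible_rep G fun_scale (ext_space B) (ext_action sc B \<rho>)"


section \<open>The Steinberg representation\<close>

text \<open>Functions on the cosets are represented by functions on all sets of matrices that
  vanish away from the cosets.\<close>

definition steinberg_space :: "nat \<Rightarrow> (('q::field^4^4) set \<Rightarrow> 'f::field) set" where
  "steinberg_space k =
     {h. (\<forall>x. x \<notin> lcosets\<^bsub>suzuki_group k\<^esub> (suzuki_P k) \<longrightarrow> h x = 0) \<and>
         (\<Sum>x\<in>lcosets\<^bsub>suzuki_group k\<^esub> (suzuki_P k). h x) = 0}"

definition steinberg_action ::
    "nat \<Rightarrow> 'q::field^4^4 \<Rightarrow> (('q^4^4) set \<Rightarrow> 'f::field) \<Rightarrow> ('q^4^4) set \<Rightarrow> 'f" where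
  "steinberg_action k g h =
     (\<lambda>x. h ((inv\<^bsub>suzuki_group k\<^esub> g) <#\<^bsub>suzuki_group k\<^esub> x))"

end

theory Submission
  imports Defs
begin

text \<open>The proof is elementary: it uses neither the tensor product theorem nor Brauer characters. Write
\<open>U\<close> for the group of the \<open>S(a,b)\<close>, \<open>H\<close> for the torus of the \<open>M(\<lambda>)\<close>, so that \<open>P = UH\<close>, and
let \<open>V\<close> be the representation. Since the field \<open>\<F>\<close> of scalars is algebraically closed, absolute
irreducibility of \<open>V\<close> is plain irreducibility.

The group has a split BN-pair of rank one: \<open>TuT\<close> lies in \<open>U H T U\<close> for each \<open>u \<noteq> 1\<close> in \<open>U\<close>
(\<open>T_S_T\<close>). As \<open>U\<close> is a 2-group and the characteristic is 2, \<open>U\<close> has nonzero fixed vectors in \<open>V\<close>,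
and \<open>H\<close> has an eigenvector among them. Replacing this vector \<open>v\<close> by its image under the Hecke
operator \<open>x \<mapsto> (\<Sum>u\<in>U. u T x)\<close>, if that is nonzero, makes \<open>V\<close> the linear span of \<open>U T v\<close>
(\<open>cyclic_highest_weight_exists\<close>). Consequently the \<open>U\<close>-coinvariants of \<open>V\<close> form a line, on
which \<open>H\<close> acts by a character \<open>\<eta>\<^sup>-\<^sup>1\<close>, where \<open>\<eta>\<close> is the weight of \<open>v\<close> (\<open>coinvariants\<close>).

Traces enter as follows. For the same reason as before \<open>U\<close>, acting by right multiplication, fixes
a nonzero element of the image of the group algebra in \<open>End V\<close>. That element factors through the
line of coinvariants, hence has rank one, and this makes the trace form on the image of the group
algebra nondegenerate (\<open>tr_nondegenerate\<close>). If all traces of group elements lie in \<open>{0, 1}\<close>, then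
squaring the coefficients of an element of the group algebra squares the traces of its products
with group elements; so the kernel of \<open>\<F>[G] \<rightarrow> End V\<close> is stable under this Frobenius twist
(\<open>group_op_frobenius_eq_0_iff\<close>). Twisting the \<open>U\<close>-fixed element above yields another one on
which \<open>H\<close> acts by the square of the character. As the coinvariants are a line, the character
equals its own square and is trivial (\<open>weight_trivial\<close>). So \<open>v\<close> is a nonzero vector fixed by \<open>P\<close>.

Finally \<open>g P \<mapsto> g v\<close> extends to an equivariant linear map from the functions on \<open>G/P\<close> to \<open>V\<close>, which
is restricted to the Steinberg space. A nonzero kernel would contain a nonzero \<open>U\<close>-fixed function;
up to a scalar this is the indicator function of all points but \<open>P\<close>, and its vanishing in \<open>V\<close> makes
\<open>v\<close> invariant under the whole group, contrary to faithfulness (\<open>orbit_map_eq_0\<close>). The restriction is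
onto because \<open>V\<close> is irreducible. The dimension \<open>q\<^sup>2\<close> is the number of points of \<open>G/P\<close> other
than \<open>P\<close>.\<close>

section \<open>The matrices of the Suzuki group\<close>

lemma vector_4 [simp]:
  "(vector [x,y,z,w] :: 'a::zero^4) $ 1 = x"
  "(vector [x,y,z,w] :: 'a::zero^4) $ 2 = y"
  "(vector [x,y,z,w] :: 'a::zero^4) $ 3 = z"
  "(vector [x,y,z,w] :: 'a::zero^4) $ 4 = w"
  unfolding vector_def by simp_all

lemma vector_4_eq_iff:
  "(vector [x1,x2,x3,x4] :: 'a::zero^4) = vector [y1,y2,y3,y4] \<longleftrightarrow>
     x1 = y1 \<and> x2 = y2 \<and> x3 = y3 \<and> x4 = y4"
  unfolding vec_eq_iff forall_4 by simp

lemma matrix_mult_4: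
  "(vector [vector [a11,a12,a13,a14], vector [a21,a22,a23,a24],
            vector [a31,a32,a33,a34], vector [a41,a42,a43,a44]] :: 'a::semiring_1^4^4) **
   vector [vector [b11,b12,b13,b14], vector [b21,b22,b23,b24],
           vector [b31,b32,b33,b34], vector [b41,b42,b43,b44]] = (
   vector [vector [a11*b11+a12*b21+a13*b31+a14*b41, a11*b12+a12*b22+a13*b32+a14*b42,
                   a11*b13+a12*b23+a13*b33+a14*b43, a11*b14+a12*b24+a13*b34+a14*b44],
           vector [a21*b11+a22*b21+a23*b31+a24*b41, a21*b12+a22*b22+a23*b32+a24*b42,
                   a21*b13+a22*b23+a23*b33+a24*b43, a21*b14+a22*b24+a23*b34+a24*b44],
           vector [a31*b11+a32*b21+a33*b31+a34*b41, a31*b12+a32*b22+a33*b32+a34*b42,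
                   a31*b13+a32*b23+a33*b33+a34*b43, a31*b14+a32*b24+a33*b34+a34*b44],
           vector [a41*b11+a42*b21+a43*b31+a44*b41, a41*b12+a42*b22+a43*b32+a44*b42,
                   a41*b13+a42*b23+a43*b33+a44*b43, a41*b14+a42*b24+a43*b34+a44*b44]] :: 'a^4^4)"
  unfolding vec_eq_iff forall_4 by (simp add: matrix_matrix_mult_def sum_4)

lemma mat_1_4:
  "(mat 1 :: 'a::semiring_1^4^4) =
     vector [vector [1,0,0,0], vector [0,1,0,0], vector [0,0,1,0], vector [0,0,0,1]]"
  unfolding vec_eq_iff forall_4 by (simp add: mat_def)

lemma finite_field_power_card:
  fixes x :: "'q::{finite,field}"
  shows "x ^ CARD('q) = x"
proof (cases "x = 0")
  case False
  have "(\<Prod>y\<in>UNIV-{0}. x * y) = x ^ (CARD('q) - 1) * \<Prod>(UNIV-{0})"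
    by (simp add: prod.distrib)
  moreover have "(\<Prod>y\<in>UNIV-{0}. x * y) = (\<Prod>y\<in>UNIV-{0}. y)"
    by (rule prod.reindex_bij_witness[of _ "\<lambda>y. y / x" "\<lambda>y. x * y"]) (use False in auto)
  ultimately have "x ^ (CARD('q) - 1) = 1"
    by simp
  thus ?thesis
    by (metis False mult.right_neutral power_Suc Suc_diff_1 finite_UNIV_card_ge_0 finite)
qed (use finite_UNIV_card_ge_0[where ?'a = 'q] in auto)

locale suzuki =
  fixes k :: nat and Q :: "'q::{finite,field} itself"
  assumes card_field: "CARD('q) = 2 ^ (2 * k + 1)"
begin

lemma two_eq_0: "(2::'q) = 0"
proof -
  have "(of_nat (CARD('q)) :: 'q) = 0"
  proof -
    have "(\<Sum>x\<in>(UNIV::'q set). x + 1) = (\<Sum>x\<in>UNIV. x)"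
      by (rule sum.reindex_bij_witness[of _ "\<lambda>y. y - 1" "\<lambda>y. y + 1"]) auto
    thus ?thesis by (simp add: sum.distrib)
  qed
  hence "(2::'q) ^ (2 * k + 1) = 0" by (simp only: card_field of_nat_power of_nat_numeral)
  thus ?thesis by (simp only: power_eq_0_iff)
qed

lemma char_eq_2: "CHAR('q) = 2"
proof -
  have "of_nat 2 = (0::'q)" using two_eq_0 by simp
  hence "CHAR('q) dvd 2" by (rule of_nat_eq_0_iff_char_dvd[THEN iffD1])
  thus ?thesis using CHAR_not_1' by (metis CHAR_not_1 One_nat_def prime_nat_iff two_is_prime_nat)
qed

lemma double [simp]: "x + x = 0" for x :: 'q
  using two_eq_0 by (metis mult_2 mult_zero_left)

lemma double_left [simp]: "x + (x + y) = y" for x :: 'q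
  by (simp flip: add.assoc)

lemma minus_id [simp]: "- x = x" for x :: 'q
  by (metis double minus_unique)

text \<open>The automorphism of the field whose square is the Frobenius map; it exists because the
  degree of the field over its prime field is odd.\<close>

definition \<theta> :: "'q \<Rightarrow> 'q" where "\<theta> a = a ^ (2 ^ (k + 1))"

lemma \<theta>_add: "\<theta> (a + b) = \<theta> a + \<theta> b"
  unfolding \<theta>_def by (rule freshmans_dream'[where n = "k+1"]) (simp_all add: char_eq_2)

lemma \<theta>_mult: "\<theta> (a * b) = \<theta> a * \<theta> b"
  by (simp add: \<theta>_def power_mult_distrib)

lemma \<theta>_divide: "\<theta> (a / b) = \<theta> a / \<theta> b"
  by (simp add: \<theta>_def power_divide)

lemma \<theta>_eq_0_iff [simp]: "\<theta> a = 0 \<longleftrightarrow> a = 0"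
  by (simp add: \<theta>_def)

lemma \<theta>_0 [simp]: "\<theta> 0 = 0" by simp

lemma \<theta>_1 [simp]: "\<theta> 1 = 1"
  by (simp add: \<theta>_def)

text \<open>The exponent \<open>2 ^ (k + 1)\<close> squares to \<open>2q\<close>, and
  \<open>x\<^sup>q = x\<close>.\<close>

lemma \<theta>_\<theta>: "\<theta> (\<theta> a) = a ^ 2"
proof -
  have "\<theta> (\<theta> a) = (a ^ (2 ^ (2*k+1))) ^ 2"
    by (simp add: \<theta>_def mult.commute flip: power_mult power_add mult_2)
  also have "a ^ (2 ^ (2*k+1)) = a"
    using finite_field_power_card[of a] by (simp only: card_field)
  finally show ?thesis .
qed

abbreviation S :: "'q \<Rightarrow> 'q \<Rightarrow> 'q^4^4" where "S \<equiv> suzuki_S k"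
abbreviation M :: "'q \<Rightarrow> 'q^4^4" where "M \<equiv> suzuki_M k"
abbreviation T :: "'q^4^4" where "T \<equiv> suzuki_T"

text \<open>The lower left entry of \<open>S a b\<close>. It decides the Bruhat cell of \<open>T
  ** S a b ** T\<close>: it is the entry that would have to vanish for that matrix to be lower
  triangular.\<close>

definition nrm :: "'q \<Rightarrow> 'q \<Rightarrow> 'q" where
  "nrm a b = a ^ 2 * \<theta> a + a * b + \<theta> b"

lemma S_eq: "S a b = vector
    [vector [1, 0, 0, 0],
     vector [a, 1, 0, 0],
     vector [b, \<theta> a, 1, 0],
     vector [nrm a b, a * \<theta> a + b, a, 1]]"
  by (simp add: suzuki_S_def \<theta>_def power_add nrm_def algebra_simps power2_eq_square)

lemma S_mult: "S a b ** S c d = S (a + c) (b + d + \<theta> a * c)"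
  unfolding S_eq matrix_mult_4 vector_4_eq_iff
  by (simp add: \<theta>_add \<theta>_mult \<theta>_\<theta> algebra_simps nrm_def power2_eq_square)

lemma S_0_0: "S 0 0 = mat 1"
  by (simp add: S_eq mat_1_4 nrm_def)

lemma S_inverse: "S a b ** S a (b + a * \<theta> a) = mat 1" "S a (b + a * \<theta> a) ** S a b = mat 1"
  by (simp_all add: S_mult algebra_simps flip: S_0_0)

lemma S_eq_iff: "S a b = S c d \<longleftrightarrow> a = c \<and> b = d"
  by (auto simp: S_eq vector_4_eq_iff)

lemma T_T: "T ** T = mat 1"
  by (simp add: suzuki_T_def mat_1_4 matrix_mult_4)

lemma M_mult: "M l ** M m = M (l * m)"
  by (simp add: suzuki_M_def matrix_mult_4 power_mult_distrib vector_4_eq_iff)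

lemma M_1: "M 1 = mat 1"
  by (simp add: suzuki_M_def mat_1_4)

lemma M_inverse: "l \<noteq> 0 \<Longrightarrow> M l ** M (inverse l) = mat 1" "l \<noteq> 0 \<Longrightarrow> M (inverse l) ** M l = mat 1"
  by (simp_all add: M_mult M_1)

lemma T_M: "T ** M l = M (inverse l) ** T"
  by (simp add: suzuki_M_def suzuki_T_def matrix_mult_4 power_inverse vector_4_eq_iff)

lemma M_S: 
  assumes "l \<noteq> 0"
  shows "M l ** S a b = S (a / l) (b / (l * \<theta> l)) ** M l"
proof -
  define L where "L = l ^ (2 ^ k)"
  have L: "L \<noteq> 0" using assms by (simp add: L_def)
  have M: "M l = vector [vector [l * L, 0,0,0], vector [0,L,0,0], vector [0,0,inverse L,0], 
    vector [0,0,0,inverse (l*L)]]"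
    by (simp add: suzuki_M_def L_def power_add)
  have tl: "\<theta> l = L ^ 2"
    by (simp add: \<theta>_def L_def mult.commute flip: power_mult)
  have tt: "\<theta> (L ^ 2) = l ^ 2"
    using \<theta>_\<theta>[of l] tl by simp
  have tL: "\<theta> (L*L) = l * l"
    using \<theta>_\<theta>[of l] tl by (simp add: power2_eq_square)
  have tLL: "\<theta> L * \<theta> L = l * l" using tL by (simp add: \<theta>_mult)
  show ?thesis
    unfolding S_eq M matrix_mult_4 vector_4_eq_iff nrm_def \<theta>_divide \<theta>_mult tl tt
    using assms L by (simp add: field_simps power2_eq_square tLL)
qed

text \<open>For \<open>a \<noteq> 0\<close>, after the substitution \<open>b = c a
  \<theta>(a)\<close> a zero of the form gives \<open>\<theta>(c) = 1 + c\<close>, hence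
  \<open>c\<^sup>2 = \<theta>(\<theta>(c)) = c\<close>. So \<open>c\<close> is \<open>0\<close> or
  \<open>1\<close>, and neither of these satisfies \<open>\<theta>(c) = 1 + c\<close>.\<close>

lemma nrm_eq_0_iff: "nrm a b = 0 \<longleftrightarrow> a = 0 \<and> b = 0"
proof
  assume z: "nrm a b = 0"
  show "a = 0 \<and> b = 0"
  proof (cases "a = 0")
    case True
    thus ?thesis using z by (simp add: nrm_def)
  next
    case False
    define c where "c = b / (a * \<theta> a)"
    have b: "b = c * (a * \<theta> a)" using False by (simp add: c_def)
    have "nrm a b = a^2 * \<theta> a * (1 + c + \<theta> c)"
      by (simp add: nrm_def b \<theta>_mult \<theta>_\<theta> power2_eq_square algebra_simps)
    hence *: "1 + c + \<theta> c = 0" using z False by simp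
    hence tc: "\<theta> c = 1 + c" by (metis add.assoc add.commute double_left add_0_right)
    have "c ^ 2 = \<theta> (1 + c)" by (simp add: tc flip: \<theta>_\<theta>)
    also have "\<dots> = c" by (simp add: \<theta>_add tc)
    finally have "c = 0 \<or> c = 1" by (simp add: power2_eq_square)
    thus ?thesis using * by auto
  qed
qed (simp add: nrm_def)


lemma power2_eq_iff_char2: "x ^ 2 = y ^ 2 \<longleftrightarrow> x = y" for x y :: 'q
proof
  assume "x ^ 2 = y ^ 2"
  hence "(x + y) ^ 2 = 0" by (simp add: power2_eq_square algebra_simps)
  hence "x + y = 0" by simp
  thus "x = y" by (metis minus_id eq_neg_iff_add_eq_0)
qed simp

text \<open>The commutation rule of the BN-pair. Comparing first rows and last columns of both
  sides, where the left factor is lower triangular, forces the parameters; in terms of \<open>f =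
  nrm a b\<close> and \<open>F = \<theta>(f)\<close> the torus element is \<open>diag(f, F/f, f/F,
  1/f)\<close>. The remaining entries agree by polynomial identities in \<open>a\<close>,
  \<open>\<theta>(a)\<close>, \<open>b\<close>, \<open>\<theta>(b)\<close> over the field of two
  elements.\<close>

lemma T_S_T:
  assumes "(a, b) \<noteq> (0, 0)"
  defines "f \<equiv> nrm a b"
  shows "T ** S a b ** T =
    S (b / f) (a / f) ** M (f ^ 2 / \<theta> f) ** T ** S ((a * \<theta> a + b) / f) (b / \<theta> f)"
proof -
  define A where "A = \<theta> a"
  define B where "B = \<theta> b"
  define F where "F = \<theta> f"
  have f0: "f \<noteq> 0" using assms(1) by (auto simp: f_def nrm_eq_0_iff)
  have F0: "F \<noteq> 0" using f0 by (simp add: F_def)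
  have f: "f = a * a * A + a * b + B"
    by (simp add: f_def nrm_def A_def B_def power2_eq_square)
  have tA: "\<theta> A = a * a" "\<theta> B = b * b" "\<theta> F = f * f"
    by (simp_all add: A_def B_def F_def \<theta>_\<theta> power2_eq_square)
  have F: "F = A * A * (a * a) + A * B + b * b"
    by (simp add: F_def f \<theta>_add \<theta>_mult tA flip: A_def B_def)
  \<comment> \<open>\<open>L\<close> is found from its square \<open>\<theta>(f\<^sup>2/F)\<close>, as \<open>2 * 2 ^ k\<close> is the exponent of \<open>\<theta>\<close>\<close>
  define L where "L = (f ^ 2 / F) ^ (2 ^ k)"
  have "L ^ 2 = \<theta> (f ^ 2 / F)"
    by (simp add: \<theta>_def L_def mult.commute flip: power_mult)
  also have "\<dots> = (F / f) ^ 2"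
    by (simp add: \<theta>_divide \<theta>_mult tA power2_eq_square flip: F_def)
  finally have L: "L = F / f" by (simp only: power2_eq_iff_char2)
  have M: "M (f ^ 2 / F) = vector [vector [f, 0,0,0], vector [0,F / f,0,0], vector [0,0,f / F,0], 
    vector [0,0,0,inverse f]]"
    using L f0 F0 unfolding L_def by (simp add: suzuki_M_def power_add power2_eq_square)
  define c where "c = a * A + b"
  define C where "C = a * a * A + B"
  have tc: "\<theta> c = C"
    by (simp add: c_def C_def \<theta>_add \<theta>_mult tA mult.commute flip: A_def B_def)
  have r1: "a * F + c * C = b * f" by (simp add: f F c_def C_def algebra_simps)
  have r2: "b * B + a * F = c * f" by (simp add: f F c_def algebra_simps)
  have r3: "b * c + F = A * f" by (simp add: f F c_def algebra_simps)
  have r4: "a * a * F + B * C = f * f" by (simp add: f F C_def algebra_simps)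
  have r5: "a * c + B = f" by (simp add: f c_def algebra_simps)
  have r6: "a * b + C = f" by (simp add: f C_def algebra_simps)
  have r7: "b * b * B + a * b * F + A * f * f = F * f" by (simp add: f F algebra_simps)
  have r8: "c * c * C + b * c * f + B * F = F * f" by (simp add: f F c_def C_def algebra_simps)
  have S1: "S (b / f) (a / f) = vector
    [vector [1, 0, 0, 0], vector [b / f, 1, 0, 0], vector [a / f, B / F, 1, 0],
     vector [1 / f, c / F, b / f, 1]]"
  proof -
    have "nrm (b / f) (a / f) = (b * b * B + a * b * F + A * f * f) / (f * f * F)"
      using f0 F0 unfolding nrm_def \<theta>_divide A_def[symmetric] B_def[symmetric] F_def[symmetric]
      by (simp add: field_simps power2_eq_square)
    also have "\<dots> = 1 / f" using f0 F0 by (simp add: r7)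
    finally have 1: "nrm (b / f) (a / f) = 1 / f" .
    have "b / f * \<theta> (b / f) + a / f = (b * B + a * F) / (f * F)"
      using f0 F0 unfolding \<theta>_divide B_def[symmetric] F_def[symmetric] by (simp add: field_simps)
    also have "\<dots> = c / F" using f0 F0 by (simp add: r2)
    finally show ?thesis unfolding S_eq 1 by (simp add: \<theta>_divide B_def F_def)
  qed
  have S2: "S (c / f) (b / F) = vector
    [vector [1, 0, 0, 0], vector [c / f, 1, 0, 0], vector [b / F, C / F, 1, 0],
     vector [1 / f, a / f, c / f, 1]]"
  proof -
    have "nrm (c / f) (b / F) = (c * c * C + b * c * f + B * F) / (f * f * F)"
      using f0 F0 unfolding nrm_def \<theta>_divide tA tc A_def[symmetric] B_def[symmetric] F_def[symmetric]
      by (simp add: field_simps power2_eq_square)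
    also have "\<dots> = 1 / f" using f0 F0 by (simp add: r8)
    finally have 1: "nrm (c / f) (b / F) = 1 / f" .
    have "c / f * \<theta> (c / f) + b / F = (c * C + b * f) / (f * F)"
      using f0 F0 unfolding \<theta>_divide tc F_def[symmetric] by (simp add: field_simps)
    also have "c * C + b * f = a * F" unfolding r1[symmetric] by (simp add: add.left_commute)
    also have "a * F / (f * F) = a / f" using F0 by simp
    finally show ?thesis unfolding S_eq 1 by (simp add: \<theta>_divide tc F_def)
  qed
  have S0: "S a b = vector
    [vector [1, 0, 0, 0], vector [a, 1, 0, 0], vector [b, A, 1, 0], vector [f, c, a, 1]]"
    by (simp add: S_eq A_def c_def f_def)
  have e: "a * b / f + C / f = 1" "b * c / f + F / f = A" "a / f + B * b / (f * F) + c / F = 0"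
    "a * a / f + B * C / (f * F) + f / F = 0" "a * c / f + B / f = 1"
    "a / f + c * C / (f * F) + b / F = 0"
  proof -
    show "a * b / f + C / f = 1" "b * c / f + F / f = A" "a * c / f + B / f = 1"
      using f0 by (simp_all add: r3 r5 r6 flip: add_divide_distrib)
    have "a / f + B * b / (f * F) + c / F = ((b * B + a * F) + c * f) / (f * F)"
      using f0 F0 by (simp add: field_simps)
    thus "a / f + B * b / (f * F) + c / F = 0" by (simp add: r2)
    have "a * a / f + B * C / (f * F) + f / F = ((a * a * F + B * C) + f * f) / (f * F)"
      using f0 F0 by (simp add: field_simps)
    thus "a * a / f + B * C / (f * F) + f / F = 0" by (simp add: r4)
    have "a / f + c * C / (f * F) + b / F = ((a * F + c * C) + b * f) / (f * F)"
      using f0 F0 by (simp add: field_simps)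
    thus "a / f + c * C / (f * F) + b / F = 0" by (simp add: r1)
  qed
  show ?thesis
    unfolding S1 S2 S0 M F_def[symmetric] suzuki_T_def matrix_mult_4 vector_4_eq_iff A_def[symmetric]
      c_def[symmetric]
    using f0 F0 e by (simp add: ac_simps inverse_eq_divide)
qed


section \<open>Bruhat decomposition\<close>

abbreviation "G \<equiv> (suzuki_group k :: ('q^4^4) monoid)"
abbreviation "GL \<equiv> (GL4 :: ('q^4^4) monoid)"
abbreviation "P \<equiv> (suzuki_P k :: ('q^4^4) set)"

lemma GL4_simps [simp]:
  "carrier GL = {A. invertible A}" "A \<otimes>\<^bsub>GL\<^esub> B = A ** B" "\<one>\<^bsub>GL\<^esub> = mat 1"
  by (simp_all add: GL4_def)

lemma suzuki_group_simps [simp]: "A \<otimes>\<^bsub>G\<^esub> B = A ** B" "\<one>\<^bsub>G\<^esub> = mat 1"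
  by (simp_all add: suzuki_group_def)

lemma group_GL4: "group GL"
proof (rule groupI)
  fix A B C assume "A \<in> carrier GL" "B \<in> carrier GL" "C \<in> carrier GL"
  thus "A \<otimes>\<^bsub>GL\<^esub> B \<in> carrier GL" "A \<otimes>\<^bsub>GL\<^esub> B \<otimes>\<^bsub>GL\<^esub> C = A \<otimes>\<^bsub>GL\<^esub> (B \<otimes>\<^bsub>GL\<^esub> C)"
    by (simp_all add: invertible_mult matrix_mul_assoc)
next
  fix A assume "A \<in> carrier GL"
  thus "\<exists>B\<in>carrier GL. B \<otimes>\<^bsub>GL\<^esub> A = \<one>\<^bsub>GL\<^esub>"
    by (auto simp: invertible_def)
qed (auto simp: invertible_def intro!: exI[of _ "mat 1"])

interpretation GL: group GL by (rule group_GL4)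

lemma invertible_gens: "invertible (S a b)" "l \<noteq> 0 \<Longrightarrow> invertible (M l)" "invertible T"
  unfolding invertible_def using S_inverse M_inverse T_T by blast+

lemma inv_gens:
  "inv\<^bsub>GL\<^esub> (S a b) = S a (b + a * \<theta> a)" "l \<noteq> 0 \<Longrightarrow> inv\<^bsub>GL\<^esub> (M l) = M (inverse l)" "inv\<^bsub>GL\<^esub> T = T"
  by (rule GL.inv_equality; simp add: S_inverse M_inverse T_T invertible_gens)+

lemma gens_subset:
  "{S a b | a b. True} \<union> {M l | l. l \<noteq> 0} \<union> {T} \<subseteq> carrier GL"
  using invertible_gens by auto

lemma subgroup_G: "subgroup (carrier G) GL"
  unfolding suzuki_group_def using GL.generate_is_subgroup[OF gens_subset] by simp

lemma group_G: "group G"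
  using GL.subgroup_imp_group[OF subgroup_G] by (simp add: suzuki_group_def)

lemma carrier_G: "carrier G = generate GL ({S a b | a b. True} \<union> {M l | l. l \<noteq> 0} \<union> {T})"
  by (simp add: suzuki_group_def)

lemma in_G [simp, intro]: "S a b \<in> carrier G" "l \<noteq> 0 \<Longrightarrow> M l \<in> carrier G" "T \<in> carrier G"
  "mat 1 \<in> carrier G"
  unfolding carrier_G by (auto intro: generate.incl simp: generate.one[where G = GL, simplified])

lemma mult_in_G [simp, intro]: "A \<in> carrier G \<Longrightarrow> B \<in> carrier G \<Longrightarrow> A ** B \<in> carrier G"
  using subgroup.m_closed[OF subgroup_G] by simp

lemma generate_stable:
  assumes g: "g \<in> generate GL E"
    and E: "\<And>e x. e \<in> E \<Longrightarrow> x \<in> Y \<Longrightarrow> e ** x \<in> Y" "\<And>e x. e \<in> E \<Longrightarrow> x \<in> Y \<Longrightarrow> (inv\<^bsub>GL\<^esub> e) ** x \<in> Y"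
    and "x \<in> Y"
  shows "g ** x \<in> Y"
  using g \<open>x \<in> Y\<close> 
  by (induction arbitrary: x rule: generate.induct) (auto simp: E simp flip: matrix_mul_assoc)

text \<open>Stability of a set under left multiplication needs to be checked on the generators
  themselves only, since the inverse of a generator is a generator of the same kind.\<close>

lemma G_stable:
  assumes "g \<in> carrier G" "x \<in> Y" "\<And>a b x. x \<in> Y \<Longrightarrow> S a b ** x \<in> Y"
    "\<And>l x. l \<noteq> 0 \<Longrightarrow> x \<in> Y \<Longrightarrow> M l ** x \<in> Y" "\<And>x. x \<in> Y \<Longrightarrow> T ** x \<in> Y"
  shows "g ** x \<in> Y"
  using assms(1) unfolding carrier_G
  by (rule generate_stable) (auto simp: assms inv_gens)

lemma P_mult: "x \<in> P \<Longrightarrow> y \<in> P \<Longrightarrow> x ** y \<in> P"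
  unfolding suzuki_P_def using generate.eng[of x GL _ y] by simp

lemma P_gens: "S a b \<in> P" "l \<noteq> 0 \<Longrightarrow> M l \<in> P"
  unfolding suzuki_P_def by (auto intro!: generate.incl)

lemma P_eq: "P = {S a b ** M l | a b l. l \<noteq> 0}"
proof
  have "g ** (S 0 0 ** M 1) \<in> {S a b ** M l | a b l. l \<noteq> 0}" if "g \<in> P" for g
    using that unfolding suzuki_P_def
  proof (rule generate_stable)
    have S: "S a b ** x \<in> {S a b ** M l | a b l. l \<noteq> 0}" if "x \<in> {S a b ** M l | a b l. l \<noteq> 0}" for a b x
      using that by (auto simp: matrix_mul_assoc S_mult) blast
    have M: "M l ** x \<in> {S a b ** M l | a b l. l \<noteq> 0}" if x: "x \<in> {S a b ** M l | a b l. l \<noteq> 0}" and l: "l \<noteq> 0" for l x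
    proof -
      obtain a b m where x: "x = S a b ** M m" "m \<noteq> 0" using x by blast
      have "M l ** x = S (a / l) (b / (l * \<theta> l)) ** M (l * m)"
        using l by (simp add: x matrix_mul_assoc M_S) (simp add: M_mult flip: matrix_mul_assoc)
      moreover have "l * m \<noteq> 0" using x l by simp
      ultimately show ?thesis unfolding x(1) by blast
    qed
    show "e ** x \<in> {S a b ** M l | a b l. l \<noteq> 0}" "(inv\<^bsub>GL\<^esub> e) ** x \<in> {S a b ** M l | a b l. l \<noteq> 0}"
      if "e \<in> {S a b | a b. True} \<union> {M l | l. l \<noteq> 0}" "x \<in> {S a b ** M l | a b l. l \<noteq> 0}" for e x
      using that(1) S[OF that(2)] M[OF that(2)] by (auto simp: inv_gens)
    show "S 0 0 ** M 1 \<in> {S a b ** M l | a b l. l \<noteq> 0}" by force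
  qed
  thus "P \<subseteq> {S a b ** M l | a b l. l \<noteq> 0}" by (simp add: S_0_0 M_1 subset_iff)
next
  show "{S a b ** M l | a b l. l \<noteq> 0} \<subseteq> P"
    by (auto intro!: P_mult P_gens)
qed

lemma subgroup_P: "subgroup P G"
proof -
  have "subgroup P GL" unfolding suzuki_P_def
    by (rule GL.generate_is_subgroup) (use gens_subset in auto)
  moreover have "P \<subseteq> carrier G"
    unfolding P_eq by auto
  ultimately show ?thesis
    using GL.subgroup_incl[OF _ subgroup_G] by (simp add: suzuki_group_def)
qed

lemma T_S_T_P:
  assumes "x \<in> P" "(a, b) \<noteq> (0, 0)"
  obtains c d p where "p \<in> P" "T ** (S a b ** (T ** x)) = S c d ** (T ** p)"
proof -
  define f where "f = nrm a b"
  have f: "f \<noteq> 0" using assms(2) by (simp add: f_def nrm_eq_0_iff)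
  define l where "l = f ^ 2 / \<theta> f"
  have l: "l \<noteq> 0" using f by (simp add: l_def)
  define u where "u = S ((a * \<theta> a + b) / f) (b / \<theta> f)"
  have "T ** (S a b ** (T ** x)) = (T ** S a b ** T) ** x"
    by (simp add: matrix_mul_assoc)
  also have "T ** S a b ** T = S (b / f) (a / f) ** (M l ** T) ** u"
    using assms(2) by (simp add: T_S_T f_def l_def u_def matrix_mul_assoc)
  also have "M l ** T = T ** M (inverse l)"
    by (simp add: T_M)
  also have "S (b / f) (a / f) ** (T ** M (inverse l)) ** u ** x = 
    S (b / f) (a / f) ** (T ** (M (inverse l) ** (u ** x)))"
    by (simp add: matrix_mul_assoc)
  finally show ?thesis
  proof (rule that[rotated])
    have "M (inverse l) \<in> P" "u \<in> P"
      unfolding suzuki_P_def u_def using l by (auto intro!: generate.incl)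
    thus "M (inverse l) ** (u ** x) \<in> P" using assms(1) by (intro P_mult)
  qed
qed

text \<open>The set \<open>P \<union> U T P\<close> contains the identity and is stable under the
  generators; for \<open>T\<close> this is the commutation rule.\<close>

lemma bruhat:
  assumes "g \<in> carrier G"
  obtains "g \<in> P" | a b p where "p \<in> P" "g = S a b ** (T ** p)"
proof -
  define Y where "Y = P \<union> {S a b ** (T ** p) | a b p. p \<in> P}"
  have S: "S a b ** x \<in> Y" if "x \<in> Y" for a b x
  proof (cases "x \<in> P")
    case True
    thus ?thesis by (simp add: Y_def P_mult P_gens)
  next
    case False
    then obtain c d p where p: "p \<in> P" "x = S c d ** (T ** p)"
      using \<open>x \<in> Y\<close> by (auto simp: Y_def)
    hence "S a b ** x = S (a + c) (b + d + \<theta> a * c) ** (T ** p)"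
      by (simp add: matrix_mul_assoc S_mult)
    thus ?thesis using p(1) unfolding Y_def by blast
  qed
  have "g ** mat 1 \<in> Y"
  proof (rule G_stable[OF assms _ S])
    show "mat 1 \<in> Y" using P_gens(1)[of 0 0] by (simp add: Y_def S_0_0)
  next
    fix l :: 'q and x assume l: "l \<noteq> 0" and "x \<in> Y"
    hence "x \<in> P \<or> (\<exists>a b p. p \<in> P \<and> x = S a b ** (T ** p))"
      by (auto simp: Y_def)
    thus "M l ** x \<in> Y"
    proof (elim disjE exE conjE)
      fix a b p assume p: "p \<in> P" "x = S a b ** (T ** p)"
      have "M l ** x = S (a / l) (b / (l * \<theta> l)) ** ((M l ** T) ** p)"
        using l by (simp add: p matrix_mul_assoc M_S)
      also have "M l ** T = T ** M (inverse l)" by (simp add: T_M)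
      also have "(T ** M (inverse l)) ** p = T ** (M (inverse l) ** p)" by (simp add: matrix_mul_assoc)
      finally have "M l ** x = S (a / l) (b / (l * \<theta> l)) ** (T ** (M (inverse l) ** p))" .
      moreover have "M (inverse l) ** p \<in> P" using l p by (simp add: P_mult P_gens)
      ultimately show ?thesis unfolding Y_def by blast
    qed (simp add: Y_def P_mult P_gens l)
  next
    fix x assume "x \<in> Y"
    hence "x \<in> P \<or> (\<exists>a b p. p \<in> P \<and> x = S a b ** (T ** p))"
      by (auto simp: Y_def)
    thus "T ** x \<in> Y"
    proof (elim disjE exE conjE)
      assume "x \<in> P"
      hence "S 0 0 ** (T ** x) \<in> Y" by (auto simp: Y_def)
      thus ?thesis by (simp add: S_0_0)
    next
      fix a b p assume p: "p \<in> P" "x = S a b ** (T ** p)"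
      show ?thesis
      proof (cases "(a, b) = (0, 0)")
        case True
        thus ?thesis using p by (simp add: S_0_0 Y_def matrix_mul_assoc T_T)
      next
        case False
        obtain c d p' where "p' \<in> P" "T ** (S a b ** (T ** p)) = S c d ** (T ** p')"
          using T_S_T_P[OF p(1) False] by blast
        thus ?thesis unfolding p(2) Y_def by blast
      qed
    qed
  qed
  hence "g \<in> Y" by simp
  thus ?thesis unfolding Y_def using that by blast
qed

lemma P_upper: "x \<in> P \<Longrightarrow> x $ 1 $ 4 = 0"
  unfolding P_eq S_eq suzuki_M_def matrix_mult_4 by auto

lemma T_notin_P: "T \<notin> P"
  using P_upper[of T] by (auto simp: suzuki_T_def)

lemma T_S_T_in_P_iff: "T ** S a b ** T \<in> P \<longleftrightarrow> a = 0 \<and> b = 0"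
proof
  assume "T ** S a b ** T \<in> P"
  from P_upper[OF this] have "nrm a b = 0"
    unfolding suzuki_T_def S_eq matrix_mult_4 by simp
  thus "a = 0 \<and> b = 0" by (simp add: nrm_eq_0_iff)
qed (use P_gens(1)[of 0 0] in \<open>simp add: S_0_0 T_T\<close>)

end

section \<open>Common eigenvectors and fixed vectors\<close>

lemma linear_simps:
  assumes "Vector_Spaces.linear sc sc' e"
  shows "e (x + y) = e x + e y" "e (x - y) = e x - e y" "e (sc c x) = sc' c (e x)" "e 0 = 0" "e (sum h A) = (\<Sum>a\<in>A. e (h a))"
proof -
  interpret e: Vector_Spaces.linear sc sc' e by fact
  show "e (x + y) = e x + e y" "e (x - y) = e x - e y" "e (sc c x) = sc' c (e x)" "e 0 = 0" "e (sum h A) = (\<Sum>a\<in>A. e (h a))"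
    by (simp_all add: e.add e.scale e.sum e.diff)
qed

lemma linear_scaleI:
  assumes "vector_space sc" "vector_space sc'" "\<And>x y. e (x + y) = e x + e y" "\<And>c x. e (sc c x) = sc' c (e x)"
  shows "Vector_Spaces.linear sc sc' e"
proof -
  interpret v1: vector_space sc by fact
  interpret v2: vector_space sc' by fact
  show ?thesis by unfold_locales (simp_all add: assms)
qed

text \<open>The value \<open>p(e) w\<close>, by Horner's scheme.\<close>

definition poly_op :: "('f::field \<Rightarrow> 'v::ab_group_add \<Rightarrow> 'v) \<Rightarrow> 'f poly \<Rightarrow> ('v \<Rightarrow> 'v) \<Rightarrow> 'v \<Rightarrow> 'v" where
  "poly_op sc p e w = fold_coeffs (\<lambda>a y. sc a w + e y) p 0"

context
  fixes sc :: "'f::field \<Rightarrow> 'v::ab_group_add \<Rightarrow> 'v" and e :: "'v \<Rightarrow> 'v"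
  assumes lin: "Vector_Spaces.linear sc sc e"
begin

interpretation e: Vector_Spaces.linear sc sc e by (rule lin)

lemma poly_op_0: "poly_op sc 0 e w = 0"
  by (simp add: poly_op_def)

lemma poly_op_pCons: "poly_op sc (pCons a p) e w = sc a w + e (poly_op sc p e w)"
proof (cases "a = 0 \<and> p = 0")
  case True
  thus ?thesis by (simp add: poly_op_0)
next
  case False
  thus ?thesis by (auto simp: poly_op_def cCons_def fold_coeffs_def)
qed

lemma poly_op_add: "poly_op sc (p + q) e w = poly_op sc p e w + poly_op sc q e w"
  by (induction p q rule: poly_induct2)
     (simp_all add: poly_op_0 poly_op_pCons e.add e.vs1.scale_left_distrib)

lemma poly_op_smult: "poly_op sc (smult c p) e w = sc c (poly_op sc p e w)"
  by (induction p) (simp_all add: poly_op_0 poly_op_pCons e.scale e.vs1.scale_right_distrib)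

lemma poly_op_mult_linear:
  "poly_op sc ([:-r, 1:] * p) e w = e (poly_op sc p e w) - sc r (poly_op sc p e w)"
proof -
  have "[:-r, 1:] * p = smult (-r) p + pCons 0 p" by simp
  thus ?thesis by (simp only: poly_op_add poly_op_smult poly_op_pCons) simp
qed

lemma poly_op_monom: "poly_op sc (monom 1 n) e w = (e ^^ n) w"
  by (induction n) (simp_all add: poly_op_pCons poly_op_0 monom_Suc monom_0)

lemma poly_op_in:
  assumes "module.subspace sc W" "e ` W \<subseteq> W" "w \<in> W"
  shows "poly_op sc p e w \<in> W"
  using assms by (induction p)
    (auto simp: poly_op_0 poly_op_pCons intro!: e.vs1.subspace_add e.vs1.subspace_scale e.vs1.subspace_0)

end

text \<open>Split a linear factor \<open>X - r\<close> off an annihilating polynomial of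
  \<open>w\<close>. Either the cofactor still annihilates \<open>w\<close>, or it maps
  \<open>w\<close> to an eigenvector for \<open>r\<close>.\<close>

lemma eigenvector_of_annihilating_poly:
  fixes sc :: "'f::alg_closed_field \<Rightarrow> 'v::ab_group_add \<Rightarrow> 'v"
  assumes lin: "Vector_Spaces.linear sc sc e" and W: "module.subspace sc W" "e ` W \<subseteq> W"
    and w: "w \<in> W" "w \<noteq> 0" and p: "p \<noteq> 0" "poly_op sc p e w = 0"
  shows "\<exists>c x. x \<in> W \<and> x \<noteq> 0 \<and> e x = sc c x"
proof -
  interpret e: Vector_Spaces.linear sc sc e by (rule lin)
  show ?thesis using p
  proof (induction "degree p" arbitrary: p)
    case 0
    then obtain a where "p = [:a:]" "a \<noteq> 0"
      by (metis degree_eq_zeroE pCons_eq_0_iff)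
    with 0 w show ?case by (simp add: poly_op_pCons[OF lin] poly_op_0[OF lin])
  next
    case (Suc n)
    obtain r where "poly p r = 0"
      using alg_closed_imp_poly_has_root[of p] Suc by auto
    then obtain q where p: "p = [:-r, 1:] * q"
      unfolding poly_eq_0_iff_dvd by (elim dvdE)
    hence q: "q \<noteq> 0" using Suc by auto
    hence deg: "degree q = n"
      using Suc(2) by (subst (asm) p, subst (asm) degree_mult_eq) auto
    show ?case
    proof (cases "poly_op sc q e w = 0")
      case True
      thus ?thesis using Suc q deg by blast
    next
      case False
      moreover have "e (poly_op sc q e w) = sc r (poly_op sc q e w)"
        using Suc(4) by (simp add: p poly_op_mult_linear[OF lin] del: mult_pCons_left)
      ultimately show ?thesis using poly_op_in[OF lin W w(1)] by blast
    qed
  qed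
qed

lemma finite_order_eigenvector:
  fixes sc :: "'f::alg_closed_field \<Rightarrow> 'v::ab_group_add \<Rightarrow> 'v"
  assumes lin: "Vector_Spaces.linear sc sc e" and W: "module.subspace sc W" "e ` W \<subseteq> W"
    and w: "w \<in> W" "w \<noteq> 0" and n: "(e ^^ n) w = w" "n > 0"
  shows "\<exists>c x. x \<in> W \<and> x \<noteq> 0 \<and> e x = sc c x"
proof (rule eigenvector_of_annihilating_poly[OF lin W w])
  interpret e: Vector_Spaces.linear sc sc e by (rule lin)
  \<comment> \<open>\<open>w\<close> is annihilated by \<open>X ^ n - 1\<close>\<close>
  let ?p = "monom 1 n + [:-1:] :: 'f poly"
  have "coeff ?p n = 1" using n(2) by (cases n) auto
  thus "?p \<noteq> 0" by (metis coeff_0 zero_neq_one)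
  show "poly_op sc ?p e w = 0"
    by (simp add: poly_op_add[OF lin] poly_op_pCons[OF lin] poly_op_0[OF lin] poly_op_monom[OF lin] n e.zero)
qed

text \<open>Each eigenspace of one operator is stable under the operators that commute with it, so
  the operators can be treated one after the other.\<close>

lemma common_eigenvector:
  fixes sc :: "'f::alg_closed_field \<Rightarrow> 'v::ab_group_add \<Rightarrow> 'v"
  assumes "finite E" and vs: "vector_space sc"
    and "module.subspace sc W" "W \<noteq> {0}"
    and "\<And>e. e \<in> E \<Longrightarrow> Vector_Spaces.linear sc sc e"
    and "\<And>e w. e \<in> E \<Longrightarrow> w \<in> W \<Longrightarrow> e w \<in> W"
    and "\<And>e w. e \<in> E \<Longrightarrow> w \<in> W \<Longrightarrow> (e ^^ n) w = w" and "n > 0"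
    and "\<And>e f w. e \<in> E \<Longrightarrow> f \<in> E \<Longrightarrow> w \<in> W \<Longrightarrow> e (f w) = f (e w)"
  shows "\<exists>x\<in>W. x \<noteq> 0 \<and> (\<forall>e\<in>E. \<exists>c. e x = sc c x)"
  using assms(1,3-)
proof (induction arbitrary: W)
  interpret vector_space sc by fact
  case empty
  thus ?case using subspace_0 by fastforce
next
  interpret vector_space sc by fact
  case (insert e E)
  obtain w where w: "w \<in> W" "w \<noteq> 0" using insert.prems subspace_0 by fastforce
  have lin: "Vector_Spaces.linear sc sc e" using insert.prems by simp
  obtain c x where x: "x \<in> W" "x \<noteq> 0" "e x = sc c x"
    using finite_order_eigenvector[OF lin insert.prems(1) _ w, of n] insert.prems w by force
  define W' where "W' = {w \<in> W. e w = sc c w}"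
  have "\<exists>x\<in>W'. x \<noteq> 0 \<and> (\<forall>e\<in>E. \<exists>c. e x = sc c x)"
  proof (rule insert.IH)
    show "subspace W'"
      using insert.prems(1) unfolding W'_def
      by (auto simp: subspace_def linear_simps[OF lin] scale_right_distrib mult.commute)
    show "W' \<noteq> {0}" using x by (auto simp: W'_def)
    show "f w \<in> W'" if "f \<in> E" "w \<in> W'" for f w
    proof -
      have "e (f w) = f (e w)" 
        using insert.prems(7)[of e f w] that by (simp add: W'_def)
      also have "\<dots> = sc c (f w)"
        using that linear_simps(3)[OF insert.prems(3)] by (simp add: W'_def)
      finally show ?thesis using that insert.prems(4) by (simp add: W'_def)
    qed
  qed (use insert.prems in \<open>auto simp: W'_def\<close>)
  thus ?case by (auto simp: W'_def)
qed

text \<open>The eigenvalues of an involution are square roots of one, and one is the only such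
  root in characteristic two.\<close>

lemma common_fixed_vector:
  fixes sc :: "'f::alg_closed_field \<Rightarrow> 'v::ab_group_add \<Rightarrow> 'v"
  assumes char: "CHAR('f) = 2"
    and "finite E" and vs: "vector_space sc"
    and W: "module.subspace sc W" "W \<noteq> {0}"
    and lin: "\<And>e. e \<in> E \<Longrightarrow> Vector_Spaces.linear sc sc e"
    and "\<And>e w. e \<in> E \<Longrightarrow> w \<in> W \<Longrightarrow> e w \<in> W"
    and inv: "\<And>e w. e \<in> E \<Longrightarrow> w \<in> W \<Longrightarrow> e (e w) = w"
    and "\<And>e f w. e \<in> E \<Longrightarrow> f \<in> E \<Longrightarrow> w \<in> W \<Longrightarrow> e (f w) = f (e w)"
  shows "\<exists>x\<in>W. x \<noteq> 0 \<and> (\<forall>e\<in>E. e x = x)"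
proof -
  interpret vector_space sc by fact
  have "\<exists>x\<in>W. x \<noteq> 0 \<and> (\<forall>e\<in>E. \<exists>c. e x = sc c x)"
    by (rule common_eigenvector[where E = E and W = W and n = 2])
       (use assms in \<open>simp_all add: eval_nat_numeral\<close>)
  then obtain x where x: "x \<in> W" "x \<noteq> 0" "\<And>e. e \<in> E \<Longrightarrow> \<exists>c. e x = sc c x" by blast
  have "e x = x" if e: "e \<in> E" for e
  proof -
    obtain c where c: "e x = sc c x" using x e by blast
    have "x = sc (c * c) x" using inv[OF e x(1)] linear_simps(3)[OF lin[OF e]] c by simp
    hence "sc (c * c - 1) x = 0" by (simp add: scale_left_diff_distrib)
    hence "c * c = 1" using x by simp
    moreover have "(1 + 1 :: 'f) = 0" using of_nat_CHAR[where 'a = 'f] by (simp add: char)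
    hence "(c - 1) * (c - 1) = c * c - 1" by (metis (no_types, opaque_lifting) add_diff_cancel_left' diff_0 diff_minus_eq_add minus_unique mult.commute mult.right_neutral mult_minus_left square_diff_one_factored)
    ultimately have "c = 1" by simp
    thus ?thesis using c by simp
  qed
  thus ?thesis using x by blast
qed

context suzuki begin

text \<open>The group \<open>U\<close> has the elementary abelian central subgroup of the \<open>S
  0 b\<close>, and modulo it every element squares to one and any two commute. So the lemma on
  commuting operators of order two applies twice, to this subgroup and then to \<open>U\<close> on
  the vectors fixed by it. The action \<open>r\<close> is arbitrary because the lemma is needed
  for \<open>V\<close>, for operators on \<open>V\<close> under right multiplication and for
  functions on \<open>G/P\<close>.\<close>

lemma unipotent_fixed_vector:
  fixes sc :: "'f::alg_closed_field \<Rightarrow> 'v::ab_group_add \<Rightarrow> 'v"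
  assumes char: "CHAR('f) = 2" and vs: "vector_space sc"
    and W: "module.subspace sc W" "W \<noteq> {0}"
    and lin: "\<And>a b. Vector_Spaces.linear sc sc (r (S a b))"
    and stable: "\<And>a b w. w \<in> W \<Longrightarrow> r (S a b) w \<in> W"
    and mult: "\<And>a b c d w. w \<in> W \<Longrightarrow> r (S a b ** S c d) w = r (S a b) (r (S c d) w)"
    and one: "\<And>w. w \<in> W \<Longrightarrow> r (mat 1) w = w"
  shows "\<exists>x\<in>W. x \<noteq> 0 \<and> (\<forall>a b. r (S a b) x = x)"
proof -
  interpret vector_space sc by fact
  define W' where "W' = {w \<in> W. \<forall>b. r (S 0 b) w = w}"
  have "\<exists>x\<in>W. x \<noteq> 0 \<and> (\<forall>e\<in>range (\<lambda>b. r (S 0 b)). e x = x)"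
    by (rule common_fixed_vector[OF char _ vs W])
       (auto simp: lin stable one S_mult S_0_0 add.commute simp flip: mult)
  then obtain x where x: "x \<in> W'" "x \<noteq> 0" by (auto simp: W'_def)
  have "\<exists>x\<in>W'. x \<noteq> 0 \<and> (\<forall>e\<in>range (\<lambda>(a, b). r (S a b)). e x = x)"
  proof (rule common_fixed_vector[OF char _ vs])
    show "subspace W'"
      using W(1) unfolding W'_def
      by (auto simp: subspace_def linear_simps[OF lin])
    show "W' \<noteq> {0}" using x by auto
    fix e w assume "e \<in> range (\<lambda>(a, b). r (S a b))" and w: "w \<in> W'"
    then obtain a b where e: "e = r (S a b)" by auto
    have wW: "w \<in> W" and fixed: "\<And>c. r (S 0 c) w = w" using w by (auto simp: W'_def)
    \<comment> \<open>on \<open>W'\<close> only the first parameter matters\<close>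
    have fix_S: "r (S c d) w = r (S c d') w" for c d d'
      using mult[OF wW, of c d 0 "d + d'"] by (simp add: fixed S_mult)
    show "e w \<in> W'"
      using wW fixed by (auto simp: W'_def e stable S_mult add.commute simp flip: mult intro: fix_S)
    show "e (e w) = w"
      using wW fixed by (auto simp: e S_mult simp flip: mult)
    fix f assume "f \<in> range (\<lambda>(a, b). r (S a b))"
    then obtain c d where f: "f = r (S c d)" by auto
    show "e (f w) = f (e w)"
      using wW by (auto simp: e f S_mult add.commute simp flip: mult intro: fix_S)
  qed (auto simp: lin)
  thus ?thesis by (auto simp: W'_def)
qed

end

section \<open>Highest weight vectors\<close>

context suzuki begin

text \<open>The group \<open>U\<close>, a Sylow 2-subgroup.\<close>

definition UU :: "('q^4^4) set" where "UU = {S a b | a b. True}"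

lemma UU_in_G: "UU \<subseteq> carrier G"
  by (auto simp: UU_def)

lemma UU_subset_P: "UU \<subseteq> P"
  by (auto simp: UU_def P_gens)

lemma one_in_UU: "mat 1 \<in> UU"
  unfolding UU_def using S_0_0 by (metis (mono_tags, lifting) mem_Collect_eq)

lemma UU_mult: "u \<in> UU \<Longrightarrow> u' \<in> UU \<Longrightarrow> u ** u' \<in> UU"
  unfolding UU_def using S_mult by blast

lemma UU_inverse: "u \<in> UU \<Longrightarrow> \<exists>u'\<in>UU. u ** u' = mat 1 \<and> u' ** u = mat 1"
  unfolding UU_def using S_inverse by blast

lemma sum_UU_left:
  assumes "w \<in> UU"
  shows "(\<Sum>u\<in>UU. f (w ** u)) = (\<Sum>u\<in>UU. f u)"
proof -
  obtain w' where w': "w' \<in> UU" "w ** w' = mat 1" "w' ** w = mat 1"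
    using UU_inverse[OF assms] by blast
  show ?thesis
    by (rule sum.reindex_bij_witness[of _ "\<lambda>u. w' ** u" "\<lambda>u. w ** u"])
       (use w' assms in \<open>auto simp: matrix_mul_assoc UU_mult\<close>)
qed

lemma sum_UU_right:
  assumes "w \<in> UU"
  shows "(\<Sum>u\<in>UU. f (u ** w)) = (\<Sum>u\<in>UU. f u)"
proof -
  obtain w' where w': "w' \<in> UU" "w ** w' = mat 1" "w' ** w = mat 1"
    using UU_inverse[OF assms] by blast
  show ?thesis
    by (rule sum.reindex_bij_witness[of _ "\<lambda>u. u ** w'" "\<lambda>u. u ** w"])
       (use w' assms in \<open>auto simp: UU_mult simp flip: matrix_mul_assoc\<close>)
qed

lemma M_UU:
  assumes "l \<noteq> 0" "u \<in> UU"
  shows "M l ** u ** M (inverse l) \<in> UU"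
proof -
  obtain a b where "u = S a b" using assms(2) by (auto simp: UU_def)
  hence "M l ** u ** M (inverse l) = S (a / l) (b / (l * \<theta> l)) ** (M l ** M (inverse l))"
    using assms(1) by (simp add: M_S matrix_mul_assoc)
  thus ?thesis using M_inverse(1)[OF assms(1)] by (auto simp: UU_def)
qed

lemma sum_UU_conj:
  assumes "l \<noteq> 0"
  shows "(\<Sum>u\<in>UU. f (M l ** u ** M (inverse l))) = (\<Sum>u\<in>UU. f u)"
proof -
  have *: "M l ** (M (inverse l) ** u) = u" "M (inverse l) ** (M l ** u) = u" for u
    using M_inverse[OF assms] by (simp_all add: matrix_mul_assoc)
  show ?thesis
  proof (rule sum.reindex_bij_witness[of _ "\<lambda>u. M (inverse l) ** u ** M l" "\<lambda>u. M l ** u ** M (inverse l)"])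
    show "M (inverse l) ** u ** M l \<in> UU" if "u \<in> UU" for u
      using M_UU[of "inverse l" u] that assms by simp
    show "M l ** u ** M (inverse l) \<in> UU" if "u \<in> UU" for u
      using M_UU that assms by simp
  qed (use M_inverse[OF assms] in \<open>auto simp: * simp flip: matrix_mul_assoc\<close>)
qed

lemma card_UU: "card UU = CARD('q) ^ 2"
proof -
  have "bij_betw (\<lambda>(a, b). S a b) UNIV UU"
    by (auto simp: bij_betw_def inj_on_def S_eq_iff UU_def)
  from bij_betw_same_card[OF this] show ?thesis
    by (simp add: power2_eq_square)
qed

lemma T_UU_T:
  assumes "u \<in> UU" "u \<noteq> mat 1"
  obtains u1 l u2 where "u1 \<in> UU" "l \<noteq> 0" "u2 \<in> UU" "T ** u ** T = u1 ** M l ** T ** u2"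
proof -
  obtain a b where u: "u = S a b" using assms by (auto simp: UU_def)
  hence ab: "(a, b) \<noteq> (0, 0)" using assms(2) S_0_0 by auto
  have "nrm a b \<noteq> 0" using ab by (auto simp: nrm_eq_0_iff)
  hence l: "nrm a b ^ 2 / \<theta> (nrm a b) \<noteq> 0" by simp
  show ?thesis
    by (rule that[OF _ l _ T_S_T[OF ab, folded u]]) (auto simp: UU_def)
qed

end

locale suzuki_rep = suzuki k Q + V: finite_dimensional_vector_space sc B
  for k :: nat and Q :: "'q::{finite,field} itself"
    and sc :: "'f::alg_closed_field \<Rightarrow> 'v::ab_group_add \<Rightarrow> 'v" and B :: "'v set" +
  fixes \<rho> :: "'q^4^4 \<Rightarrow> 'v \<Rightarrow> 'v"
  assumes char2: "CHAR('f) = 2"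
    and hom: "\<rho> \<in> hom G (Aut sc)"
    and irreducible: "V.subspace W \<Longrightarrow> (\<And>g x. g \<in> carrier G \<Longrightarrow> x \<in> W \<Longrightarrow> \<rho> g x \<in> W) \<Longrightarrow> W = {0} \<or> W = UNIV"
    and nonzero: "\<exists>v::'v. v \<noteq> 0"
begin

lemma rho_linear: "g \<in> carrier G \<Longrightarrow> Vector_Spaces.linear sc sc (\<rho> g)"
  using hom by (auto simp: hom_def Aut_def Pi_def)

lemma rho_bij: "g \<in> carrier G \<Longrightarrow> bij (\<rho> g)"
  using hom by (auto simp: hom_def Aut_def Pi_def)

lemmas rho_simps = linear_simps[OF rho_linear]

lemma rho_mult: "g \<in> carrier G \<Longrightarrow> h \<in> carrier G \<Longrightarrow> \<rho> (g ** h) x = \<rho> g (\<rho> h x)"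
  using hom by (auto simp: hom_def Aut_def)

lemma rho_1 [simp]: "\<rho> (mat 1) x = x"
  using rho_mult[of "mat 1" "mat 1" x] bij_is_inj[OF rho_bij, of "mat 1"] by (simp add: inj_eq)

lemma two_eq_0_f: "(1 + 1 :: 'f) = 0"
  using of_nat_CHAR[where 'a = 'f] by (simp add: char2)

lemma UU_G [simp]: "u \<in> UU \<Longrightarrow> u \<in> carrier G"
  using UU_in_G by auto

lemma G_inverse:
  assumes "g \<in> carrier G"
  obtains h where "h \<in> carrier G" "g ** h = mat 1" "h ** g = mat 1"
  using group.Units_eq[OF group_G] group.r_inv[OF group_G assms] group.l_inv[OF group_G assms]
    group.inv_closed[OF group_G assms] by auto

lemma stable_of_gens:
  assumes W: "V.subspace W" 
    and "\<And>u x. u \<in> UU \<Longrightarrow> x \<in> W \<Longrightarrow> \<rho> u x \<in> W"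
    and "\<And>l x. l \<noteq> 0 \<Longrightarrow> x \<in> W \<Longrightarrow> \<rho> (M l) x \<in> W"
    and "\<And>x. x \<in> W \<Longrightarrow> \<rho> T x \<in> W"
    and "g \<in> carrier G" "x \<in> W"
  shows "\<rho> g x \<in> W"
proof -
  let ?Y = "{g \<in> carrier G. \<forall>x\<in>W. \<rho> g x \<in> W}"
  have "g ** mat 1 \<in> ?Y"
  proof (rule G_stable[OF \<open>g \<in> carrier G\<close>])
    have "S a b \<in> UU" for a b by (auto simp: UU_def)
    thus "S a b ** h \<in> ?Y" if "h \<in> ?Y" for a b h
      using that assms(2) by (simp add: rho_mult)
  qed (use assms(3,4) in \<open>auto simp: rho_mult\<close>)
  thus ?thesis using assms by simp
qed

definition hecke :: "'v \<Rightarrow> 'v" where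
  "hecke x = (\<Sum>u\<in>UU. \<rho> u (\<rho> T x))"

definition highest_weight :: "('q \<Rightarrow> 'f) \<Rightarrow> 'v \<Rightarrow> bool" where
  "highest_weight \<eta> v \<longleftrightarrow> v \<noteq> 0 \<and> (\<forall>u\<in>UU. \<rho> u v = v) \<and> (\<forall>l. l \<noteq> 0 \<longrightarrow> \<rho> (M l) v = sc (\<eta> l) v)"

lemma highest_weight_exists: "\<exists>\<eta> v. highest_weight \<eta> v"
proof -
  define W where "W = {v. \<forall>u\<in>UU. \<rho> u v = v}"
  have sub: "V.subspace W"
    by (auto simp: W_def V.subspace_def rho_simps)
  have "\<exists>x\<in>UNIV. x \<noteq> 0 \<and> (\<forall>a b. \<rho> (S a b) x = x)"
    by (rule unipotent_fixed_vector[OF char2 V.vector_space_axioms])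
       (use nonzero in \<open>auto simp: rho_linear rho_mult\<close>)
  hence W0: "W \<noteq> {0}" by (auto simp: W_def UU_def)
  have "\<exists>x\<in>W. x \<noteq> 0 \<and> (\<forall>e\<in>{\<rho> (M l) | l. l \<noteq> 0}. \<exists>c. e x = sc c x)"
  proof (rule common_eigenvector[OF _ V.vector_space_axioms sub W0])
    show "finite {\<rho> (M l) | l. l \<noteq> 0}" by simp
    have "(1::nat) < 2 ^ (2 * k + 1)" by (rule one_less_power) simp_all
    thus n: "CARD('q) - 1 > 0" by (simp only: card_field zero_less_diff)
    fix e x assume e: "e \<in> {\<rho> (M l) | l. l \<noteq> 0}"
    then obtain l where l: "l \<noteq> 0" "e = \<rho> (M l)" by auto
    show "Vector_Spaces.linear sc sc e" by (simp add: l rho_linear)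
    assume x: "x \<in> W"
    show "e x \<in> W"
    proof -
      have "\<rho> u (\<rho> (M l) x) = \<rho> (M l) x" if u: "u \<in> UU" for u
      proof -
        define w where "w = M (inverse l) ** u ** M l"
        have w: "w \<in> UU" using M_UU[of "inverse l" u] u l by (simp add: w_def)
        have "M l ** w = u ** M l"
          using M_inverse[OF l(1)] by (simp add: w_def matrix_mul_assoc)
        hence "\<rho> u (\<rho> (M l) x) = \<rho> (M l) (\<rho> w x)"
          using u w l by (simp flip: rho_mult)
        thus ?thesis using x w by (simp add: W_def)
      qed
      thus ?thesis by (simp add: W_def l)
    qed
    have "(e ^^ m) x = \<rho> (M (l ^ m)) x" for m
      using l by (induction m) (auto simp: M_1 simp flip: rho_mult M_mult)
    moreover have "l ^ (CARD('q) - 1) = 1"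
    proof -
      have "l * l ^ (CARD('q) - 1) = l" 
        using finite_field_power_card[of l] n by (metis Suc_diff_1 finite_UNIV_card_ge_0 finite power_Suc)
      thus ?thesis using l by simp
    qed
    ultimately show "(e ^^ (CARD('q) - 1)) x = x" by (simp add: M_1)
    fix f assume "f \<in> {\<rho> (M l) | l. l \<noteq> 0}"
    then obtain m where "m \<noteq> 0" "f = \<rho> (M m)" by auto
    thus "e (f x) = f (e x)" using l by (simp add: M_mult mult.commute flip: rho_mult)
  qed
  then obtain v where v: "v \<in> W" "v \<noteq> 0" "\<And>l. l \<noteq> 0 \<Longrightarrow> \<exists>c. \<rho> (M l) v = sc c v" by blast
  then obtain \<eta> where "\<And>l. l \<noteq> 0 \<Longrightarrow> \<rho> (M l) v = sc (\<eta> l) v" by metis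
  hence "highest_weight \<eta> v" using v by (auto simp: highest_weight_def W_def)
  thus ?thesis by blast
qed

lemma M_T_highest_weight:
  assumes "highest_weight \<eta> v" "l \<noteq> 0"
  shows "\<rho> (M l) (\<rho> T v) = sc (\<eta> (inverse l)) (\<rho> T v)"
proof -
  have "M l ** T = T ** M (inverse l)" by (simp add: T_M)
  hence "\<rho> (M l) (\<rho> T v) = \<rho> T (\<rho> (M (inverse l)) v)"
    using assms by (simp flip: rho_mult)
  also have "\<dots> = sc (\<eta> (inverse l)) (\<rho> T v)"
    using assms by (simp add: highest_weight_def rho_simps)
  finally show ?thesis .
qed

lemma M_rho_UU:
  assumes l: "l \<noteq> 0" and u: "u \<in> UU"
  shows "\<rho> (M l) (\<rho> u x) = \<rho> (M l ** u ** M (inverse l)) (\<rho> (M l) x)"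
proof -
  have "M l ** u = (M l ** u ** M (inverse l)) ** M l"
    using M_inverse[OF l] by (simp flip: matrix_mul_assoc)
  hence "\<rho> (M l ** u) x = \<rho> ((M l ** u ** M (inverse l)) ** M l) x"
    by simp
  thus ?thesis
    using rho_mult[OF in_G(2)[OF l] UU_G[OF u]] rho_mult[OF UU_G[OF M_UU[OF l u]] in_G(2)[OF l]]
    by simp
qed

text \<open>In \<open>T u T = u\<^sub>1 h T u\<^sub>2\<close> the factor \<open>u\<^sub>2\<close>
  fixes \<open>v\<close>, and \<open>h\<close> acts on \<open>T v\<close> by a scalar.\<close>

lemma T_UU_T_highest_weight:
  assumes v: "highest_weight \<eta> v" and u: "u \<in> UU" "u \<noteq> mat 1"
  shows "\<exists>c. \<exists>u1\<in>UU. \<rho> T (\<rho> u (\<rho> T v)) = sc c (\<rho> u1 (\<rho> T v))"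
proof -
  obtain u1 l u2 where *: "u1 \<in> UU" "l \<noteq> 0" "u2 \<in> UU" "T ** u ** T = u1 ** M l ** T ** u2"
    using T_UU_T[OF u] by blast
  have "\<rho> T (\<rho> u (\<rho> T v)) = \<rho> (T ** u ** T) v"
    using u by (simp add: rho_mult)
  also have "\<dots> = \<rho> u1 (\<rho> (M l) (\<rho> T (\<rho> u2 v)))"
    unfolding *(4) using * by (simp add: rho_mult)
  also have "\<rho> u2 v = v" using v * by (simp add: highest_weight_def)
  also have "\<rho> u1 (\<rho> (M l) (\<rho> T v)) = sc (\<eta> (inverse l)) (\<rho> u1 (\<rho> T v))"
    using * by (simp add: M_T_highest_weight[OF v] rho_simps)
  finally show ?thesis using * by blast
qed

lemma T_hecke_highest_weight:
  assumes v: "highest_weight \<eta> v"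
  obtains c f where "\<And>u. u \<in> UU - {mat 1} \<Longrightarrow> f u \<in> UU"
    "\<rho> T (hecke v) = v + (\<Sum>u\<in>UU - {mat 1}. sc (c u) (\<rho> (f u) (\<rho> T v)))"
proof -
  obtain c f where cf: "\<And>u. u \<in> UU - {mat 1} \<Longrightarrow> f u \<in> UU \<and> \<rho> T (\<rho> u (\<rho> T v)) = sc (c u) (\<rho> (f u) (\<rho> T v))"
    using T_UU_T_highest_weight[OF v] by (metis DiffD1 DiffD2 insertI1)
  have "\<rho> T (hecke v) = (\<Sum>u\<in>UU. \<rho> T (\<rho> u (\<rho> T v)))"
    by (simp add: hecke_def rho_simps)
  also have "\<dots> = \<rho> T (\<rho> T v) + (\<Sum>u\<in>UU - {mat 1}. \<rho> T (\<rho> u (\<rho> T v)))"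
    using one_in_UU by (subst sum.remove[of _ "mat 1"]) auto
  also have "\<rho> T (\<rho> T v) = v" by (simp add: T_T flip: rho_mult)
  also have "(\<Sum>u\<in>UU - {mat 1}. \<rho> T (\<rho> u (\<rho> T v))) = (\<Sum>u\<in>UU - {mat 1}. sc (c u) (\<rho> (f u) (\<rho> T v)))"
    using cf by (intro sum.cong) auto
  finally show ?thesis using that cf by blast
qed

lemma sum_UU_const: "(\<Sum>u\<in>UU. x) = (0::'v)"
proof -
  have "x + x = 0" for x :: 'v
    using two_eq_0_f by (metis V.scale_left_distrib V.scale_one V.scale_zero_left)
  hence *: "(\<Sum>i\<in>A. x) = 0" if "even (card A)" "finite A" for A :: "('q^4^4) set" and x :: 'v
  proof -
    have "(\<Sum>i\<in>A. x) = sc (of_nat (card A)) x"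
      using that(2) by (induction A rule: finite_induct) (simp_all add: V.scale_left_distrib)
    also have "of_nat (card A) = (0::'f)"
      using that(1) by (metis char2 of_nat_eq_0_iff_char_dvd)
    finally show ?thesis by simp
  qed
  show ?thesis by (rule *) (simp_all add: card_UU card_field)
qed

text \<open>In the double sum the terms \<open>T u T\<close> with \<open>u \<noteq> 1\<close>
  contribute multiples of \<open>hecke v\<close>, since the outer sum absorbs the factor from
  \<open>U\<close>; the term \<open>u = 1\<close> contributes \<open>q\<^sup>2\<close> copies of
  \<open>v\<close>, that is, zero.\<close>

lemma hecke_hecke:
  assumes v: "highest_weight \<eta> v"
  shows "\<exists>a. hecke (hecke v) = sc a (hecke v)"
proof -
  obtain c f where cf: "\<And>u. u \<in> UU - {mat 1} \<Longrightarrow> f u \<in> UU"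
    "\<rho> T (hecke v) = v + (\<Sum>u\<in>UU - {mat 1}. sc (c u) (\<rho> (f u) (\<rho> T v)))"
    using T_hecke_highest_weight[OF v] by blast
  have "hecke (hecke v) = (\<Sum>w\<in>UU. \<rho> w v + (\<Sum>u\<in>UU - {mat 1}. sc (c u) (\<rho> w (\<rho> (f u) (\<rho> T v)))))"
    by (subst (1) hecke_def) (simp add: cf rho_simps)
  also have "\<dots> = (\<Sum>w\<in>UU. v) + (\<Sum>u\<in>UU - {mat 1}. \<Sum>w\<in>UU. sc (c u) (\<rho> w (\<rho> (f u) (\<rho> T v))))"
    using v by (simp add: sum.distrib highest_weight_def sum.swap[of _ "UU - {mat 1}" UU])
  also have "(\<Sum>w\<in>UU. v) = 0" by (rule sum_UU_const)
  also have "(\<Sum>u\<in>UU - {mat 1}. \<Sum>w\<in>UU. sc (c u) (\<rho> w (\<rho> (f u) (\<rho> T v)))) = 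
    (\<Sum>u\<in>UU - {mat 1}. sc (c u) (hecke v))"
  proof (intro sum.cong refl)
    fix u assume u: "u \<in> UU - {mat 1}"
    have "(\<Sum>w\<in>UU. sc (c u) (\<rho> w (\<rho> (f u) (\<rho> T v)))) = sc (c u) (\<Sum>w\<in>UU. \<rho> (w ** f u) (\<rho> T v))"
      using cf(1)[OF u] by (simp add: V.scale_sum_right rho_mult)
    also have "(\<Sum>w\<in>UU. \<rho> (w ** f u) (\<rho> T v)) = hecke v"
      unfolding hecke_def by (rule sum_UU_right[OF cf(1)[OF u]])
    finally show "(\<Sum>w\<in>UU. sc (c u) (\<rho> w (\<rho> (f u) (\<rho> T v)))) = sc (c u) (hecke v)" .
  qed
  also have "0 + (\<Sum>u\<in>UU - {mat 1}. sc (c u) (hecke v)) = sc (\<Sum>u\<in>UU - {mat 1}. c u) (hecke v)"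
    by (simp add: V.scale_sum_left)
  finally show ?thesis by blast
qed

lemma highest_weight_hecke:
  assumes v: "highest_weight \<eta> v" and "hecke v \<noteq> 0"
  shows "highest_weight (\<lambda>l. \<eta> (inverse l)) (hecke v)"
  unfolding highest_weight_def
proof (intro conjI ballI allI impI)
  fix w assume w: "w \<in> UU"
  have "\<rho> w (hecke v) = (\<Sum>u\<in>UU. \<rho> (w ** u) (\<rho> T v))"
    using w by (simp add: hecke_def rho_simps rho_mult)
  also have "\<dots> = hecke v"
    unfolding hecke_def by (rule sum_UU_left[OF w])
  finally show "\<rho> w (hecke v) = hecke v" .
next
  fix l :: 'q assume l: "l \<noteq> 0"
  have "\<rho> (M l) (hecke v) = (\<Sum>u\<in>UU. \<rho> (M l) (\<rho> u (\<rho> T v)))"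
    using l by (simp add: hecke_def rho_simps)
  also have "\<dots> = (\<Sum>u\<in>UU. sc (\<eta> (inverse l)) (\<rho> (M l ** u ** M (inverse l)) (\<rho> T v)))"
  proof (intro sum.cong refl)
    fix u assume u: "u \<in> UU"
    have "\<rho> (M l) (\<rho> u (\<rho> T v)) = \<rho> (M l ** u ** M (inverse l)) (\<rho> (M l) (\<rho> T v))"
      by (rule M_rho_UU[OF l u])
    also have "\<dots> = sc (\<eta> (inverse l)) (\<rho> (M l ** u ** M (inverse l)) (\<rho> T v))"
      using u l by (simp add: M_T_highest_weight[OF v] rho_simps M_UU)
    finally show "\<rho> (M l) (\<rho> u (\<rho> T v)) = \<dots>" .
  qed
  also have "\<dots> = sc (\<eta> (inverse l)) (\<Sum>u\<in>UU. \<rho> (M l ** u ** M (inverse l)) (\<rho> T v))"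
    by (simp add: V.scale_sum_right)
  also have "(\<Sum>u\<in>UU. \<rho> (M l ** u ** M (inverse l)) (\<rho> T v)) = hecke v"
    unfolding hecke_def by (rule sum_UU_conj[OF l])
  finally show "\<rho> (M l) (hecke v) = sc (\<eta> (inverse l)) (hecke v)" .
qed (use assms in auto)

text \<open>By irreducibility it is enough that the span of \<open>U T v\<close> is stable under
  the group. The only doubtful image is that of \<open>T v\<close> under \<open>T\<close>, which
  is \<open>v\<close>. If the eigenvalue is nonzero, then \<open>v\<close> is a multiple of the
  sum defining \<open>hecke v\<close>; if it is zero, then applying \<open>T\<close> to the
  equation \<open>hecke v = 0\<close> expresses \<open>v\<close> through the other terms.\<close>

lemma cyclic_of_hecke_eigenvector:
  assumes v: "highest_weight \<eta> v" and a: "hecke v = sc a v"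
  shows "V.span {\<rho> u (\<rho> T v) | u. u \<in> UU} = UNIV"
proof -
  let ?W = "V.span {\<rho> u (\<rho> T v) | u. u \<in> UU}"
  have gen: "\<rho> u (\<rho> T v) \<in> ?W" if "u \<in> UU" for u
    using that by (auto intro: V.span_base)
  have vW: "v \<in> ?W"
  proof (cases "a = 0")
    case True
    obtain c f where cf: "\<And>u. u \<in> UU - {mat 1} \<Longrightarrow> f u \<in> UU"
      "\<rho> T (hecke v) = v + (\<Sum>u\<in>UU - {mat 1}. sc (c u) (\<rho> (f u) (\<rho> T v)))"
      using T_hecke_highest_weight[OF v] by blast
    have "v = - (\<Sum>u\<in>UU - {mat 1}. sc (c u) (\<rho> (f u) (\<rho> T v)))"
      using cf(2) True a by (simp add: rho_simps eq_neg_iff_add_eq_0)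
    also have "\<dots> \<in> ?W"
      by (intro V.span_neg V.span_sum V.span_scale gen cf)
    finally show ?thesis .
  next
    case False
    have "hecke v \<in> ?W" unfolding hecke_def by (intro V.span_sum gen)
    hence "sc (inverse a) (hecke v) \<in> ?W" by (rule V.span_scale)
    thus ?thesis using False by (simp add: a)
  qed
  have stable: "\<rho> g x \<in> ?W" if g: "g \<in> carrier G" and x: "x \<in> ?W"
    and *: "\<And>u. u \<in> UU \<Longrightarrow> \<rho> g (\<rho> u (\<rho> T v)) \<in> ?W" for g x
    using x
  proof (induction rule: V.span_induct_alt)
    case base
    thus ?case using g by (simp add: rho_simps V.span_zero)
  next
    case (step c x y)
    thus ?case using g * by (auto simp: rho_simps intro!: V.span_add V.span_scale)
  qed
  have "?W = {0} \<or> ?W = UNIV"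
  proof (rule irreducible)
    show "V.subspace ?W" by simp
    show "\<rho> g x \<in> ?W" if "g \<in> carrier G" "x \<in> ?W" for g x
    proof (rule stable_of_gens[OF _ _ _ _ that])
      show "\<rho> w x \<in> ?W" if w: "w \<in> UU" and x: "x \<in> ?W" for w x
      proof (rule stable[OF _ x])
        show "\<rho> w (\<rho> u (\<rho> T v)) \<in> ?W" if "u \<in> UU" for u
          using gen[OF UU_mult[OF w that]] w that by (simp add: rho_mult)
      qed (use w in simp)
      show "\<rho> (M l) x \<in> ?W" if l: "l \<noteq> 0" and x: "x \<in> ?W" for l x
      proof (rule stable[OF _ x])
        show "\<rho> (M l) (\<rho> u (\<rho> T v)) \<in> ?W" if u: "u \<in> UU" for u
        proof -
          have "\<rho> (M l) (\<rho> u (\<rho> T v)) = \<rho> (M l ** u ** M (inverse l)) (\<rho> (M l) (\<rho> T v))"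
            by (rule M_rho_UU[OF l u])
          also have "\<dots> = sc (\<eta> (inverse l)) (\<rho> (M l ** u ** M (inverse l)) (\<rho> T v))"
            using u l by (simp add: M_T_highest_weight[OF v] rho_simps M_UU)
          also have "\<dots> \<in> ?W" by (intro V.span_scale gen M_UU l u)
          finally show ?thesis .
        qed
      qed (use l in simp)
      show "\<rho> T x \<in> ?W" if x: "x \<in> ?W" for x
      proof (rule stable[OF _ x])
        show "\<rho> T (\<rho> u (\<rho> T v)) \<in> ?W" if u: "u \<in> UU" for u
        proof (cases "u = mat 1")
          case True
          thus ?thesis using vW by (simp add: T_T flip: rho_mult)
        next
          case False
          then obtain c u1 where "u1 \<in> UU" "\<rho> T (\<rho> u (\<rho> T v)) = sc c (\<rho> u1 (\<rho> T v))"
            using T_UU_T_highest_weight[OF v u] by blast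
          thus ?thesis using V.span_scale[OF gen] by simp
        qed
      qed simp
    qed simp
  qed
  moreover have "v \<noteq> 0" using v by (simp add: highest_weight_def)
  ultimately show ?thesis using vW by auto
qed

text \<open>If a highest weight vector \<open>v\<close> is not annihilated by the Hecke operator,
  then \<open>hecke v\<close> is an eigenvector of it, of the inverse weight.\<close>

lemma cyclic_highest_weight_exists:
  "\<exists>\<eta> v. highest_weight \<eta> v \<and> V.span {\<rho> u (\<rho> T v) | u. u \<in> UU} = UNIV"
proof -
  obtain \<eta> v where v: "highest_weight \<eta> v" using highest_weight_exists by blast
  show ?thesis
  proof (cases "hecke v = 0")
    case True
    thus ?thesis using cyclic_of_hecke_eigenvector[OF v, of 0] v by auto
  next
    case False
    obtain a where "hecke (hecke v) = sc a (hecke v)" using hecke_hecke[OF v] by blast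
    thus ?thesis using cyclic_of_hecke_eigenvector highest_weight_hecke[OF v False] by blast
  qed
qed

end

section \<open>The group algebra and its trace form\<close>

context suzuki_rep begin

text \<open>The action on \<open>V\<close> of the element \<open>\<Sum>g. a g g\<close> of the
  group algebra.\<close>

definition group_op :: "('q^4^4 \<Rightarrow> 'f) \<Rightarrow> 'v \<Rightarrow> 'v" where
  "group_op a x = (\<Sum>g\<in>carrier G. sc (a g) (\<rho> g x))"

lemma group_op_linear: "Vector_Spaces.linear sc sc (group_op a)"
  by (rule linear_scaleI[OF V.vector_space_axioms V.vector_space_axioms])
     (simp_all add: group_op_def rho_simps V.scale_right_distrib sum.distrib V.scale_sum_right mult.commute)

lemmas group_op_simps = linear_simps[OF group_op_linear]

lemma group_op_add: "group_op (\<lambda>g. a g + b g) x = group_op a x + group_op b x"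
  by (simp add: group_op_def V.scale_left_distrib sum.distrib)

lemma group_op_diff: "group_op (\<lambda>g. a g - b g) x = group_op a x - group_op b x"
  by (simp add: group_op_def V.scale_left_diff_distrib sum_subtractf)

lemma group_op_scale: "group_op (\<lambda>g. c * a g) x = sc c (group_op a x)"
  by (simp add: group_op_def V.scale_sum_right)

lemma group_op_0: "group_op (\<lambda>g. 0) x = 0"
  by (simp add: group_op_def)

lemma group_op_single:
  assumes "h \<in> carrier G"
  shows "group_op (\<lambda>g. if g = h then 1 else 0) x = \<rho> h x"
proof -
  have "group_op (\<lambda>g. if g = h then 1 else 0) x = (\<Sum>g\<in>carrier G. if g = h then \<rho> h x else 0)"
    unfolding group_op_def by (intro sum.cong) auto
  thus ?thesis using assms by simp
qed

lemma group_op_right: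
  assumes h: "h \<in> carrier G" "h ** h' = mat 1" "h' ** h = mat 1" "h' \<in> carrier G"
  shows "group_op (\<lambda>g. a (g ** h')) x = group_op a (\<rho> h x)"
proof -
  have "group_op (\<lambda>g. a (g ** h')) x = (\<Sum>g\<in>carrier G. sc (a g) (\<rho> (g ** h) x))"
    unfolding group_op_def
    by (rule sum.reindex_bij_witness[of _ "\<lambda>g. g ** h" "\<lambda>g. g ** h'"])
       (use h in \<open>auto simp flip: matrix_mul_assoc\<close>)
  also have "\<dots> = group_op a (\<rho> h x)"
    unfolding group_op_def using h by (intro sum.cong) (simp_all add: rho_mult)
  finally show ?thesis .
qed

lemma group_op_left:
  assumes h: "h \<in> carrier G" "h ** h' = mat 1" "h' ** h = mat 1" "h' \<in> carrier G"
  shows "group_op (\<lambda>g. a (h' ** g)) x = \<rho> h (group_op a x)"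
proof -
  have "group_op (\<lambda>g. a (h' ** g)) x = (\<Sum>g\<in>carrier G. sc (a g) (\<rho> (h ** g) x))"
    unfolding group_op_def
    by (rule sum.reindex_bij_witness[of _ "\<lambda>g. h ** g" "\<lambda>g. h' ** g"])
       (use h in \<open>auto simp: matrix_mul_assoc\<close>)
  also have "\<dots> = \<rho> h (group_op a x)"
    unfolding group_op_def using h by (simp add: rho_mult rho_simps)
  finally show ?thesis .
qed

lemma group_op_comp: "\<exists>c. \<forall>x. group_op a (group_op b x) = group_op c x"
proof -
  have "\<exists>h'. h' \<in> carrier G \<and> h ** h' = mat 1 \<and> h' ** h = mat 1" if "h \<in> carrier G" for h
    using G_inverse[OF that] by blast
  then obtain i where i: "\<And>h. h \<in> carrier G \<Longrightarrow> i h \<in> carrier G \<and> h ** i h = mat 1 \<and> i h ** h = mat 1"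
    by metis
  have "group_op a (group_op b x) = group_op (\<lambda>g. \<Sum>h\<in>carrier G. a h * b (i h ** g)) x" for x
  proof -
    have "group_op a (group_op b x) = (\<Sum>h\<in>carrier G. sc (a h) (group_op (\<lambda>g. b (i h ** g)) x))"
      unfolding group_op_def[of a] using i by (intro sum.cong) (simp_all add: group_op_left)
    also have "\<dots> = (\<Sum>g\<in>carrier G. \<Sum>h\<in>carrier G. sc (a h * b (i h ** g)) (\<rho> g x))"
      by (subst sum.swap) (simp add: group_op_def V.scale_sum_right)
    finally show ?thesis by (simp add: group_op_def V.scale_sum_left)
  qed
  thus ?thesis by blast
qed

text \<open>The vectors \<open>group_op a x\<close> form a nonzero subrepresentation.\<close>

lemma group_op_transitive:
  assumes "x \<noteq> 0"
  shows "\<exists>a. group_op a x = y"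
proof -
  let ?W = "range (\<lambda>a. group_op a x)"
  have "?W = {0} \<or> ?W = UNIV"
  proof (rule irreducible)
    show "V.subspace ?W"
      unfolding V.subspace_def
    proof safe
      show "0 \<in> ?W" using group_op_0[of x] by (metis rangeI)
      show "group_op a x + group_op b x \<in> ?W" for a b by (simp flip: group_op_add)
      show "sc c (group_op a x) \<in> ?W" for a c by (simp flip: group_op_scale)
    qed
    show "\<rho> g z \<in> ?W" if "g \<in> carrier G" "z \<in> ?W" for g z
    proof -
      obtain a where a: "z = group_op a x" using \<open>z \<in> ?W\<close> by blast
      obtain h where h: "h \<in> carrier G" "g ** h = mat 1" "h ** g = mat 1"
        using G_inverse[OF \<open>g \<in> carrier G\<close>] by blast
      show ?thesis
        unfolding a group_op_left[OF that(1) h(2,3,1), symmetric] by blast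
    qed
  qed
  moreover have "x \<in> ?W" 
    by (rule range_eqI[of _ _ "\<lambda>g. if g = mat 1 then 1 else 0"]) (simp add: group_op_single)
  ultimately have "?W = UNIV" using assms by auto
  hence "y \<in> ?W" by simp
  thus ?thesis by auto
qed

text \<open>A \<open>U\<close>-invariant linear map is determined by its value at \<open>T
  v\<close>, because \<open>V\<close> is spanned by \<open>U T v\<close>. The torus normalizes
  \<open>U\<close> and acts on \<open>T v\<close> by the inverse weight.\<close>

lemma coinvariants:
  assumes v: "highest_weight \<eta> v" and cyclic: "V.span {\<rho> u (\<rho> T v) | u. u \<in> UU} = UNIV"
    and f: "Vector_Spaces.linear sc sc f" "\<And>u x. u \<in> UU \<Longrightarrow> f (\<rho> u x) = f x"
  shows "l \<noteq> 0 \<Longrightarrow> f (\<rho> (M l) x) = sc (\<eta> (inverse l)) (f x)" "\<exists>c. f x = sc c (f (\<rho> T v))"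
proof -
  note f_simps = linear_simps[OF f(1)]
  have x: "x \<in> V.span {\<rho> u (\<rho> T v) | u. u \<in> UU}" using cyclic by simp
  show "f (\<rho> (M l) x) = sc (\<eta> (inverse l)) (f x)" if l: "l \<noteq> 0"
    using x
  proof (induction rule: V.span_induct_alt)
    case base
    thus ?case using l by (simp add: rho_simps f_simps)
  next
    case (step c x y)
    then obtain u where u: "x = \<rho> u (\<rho> T v)" "u \<in> UU" by blast
    have "f (\<rho> (M l) x) = sc (\<eta> (inverse l)) (f x)"
      using l u by (simp add: M_rho_UU f M_UU M_T_highest_weight[OF v] f_simps)
    thus ?case using l step by (simp add: rho_simps f_simps V.scale_right_distrib mult.commute)
  qed
  show "\<exists>c. f x = sc c (f (\<rho> T v))"
    using x
  proof (induction rule: V.span_induct_alt)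
    case base
    show ?case by (rule exI[of _ 0]) (simp add: f_simps)
  next
    case (step c x y)
    then obtain u where u: "x = \<rho> u (\<rho> T v)" "u \<in> UU" by blast
    obtain d where d: "f y = sc d (f (\<rho> T v))" using step by blast
    have "f (sc c x + y) = sc (c + d) (f (\<rho> T v))"
      by (simp add: f_simps u f d V.scale_left_distrib)
    thus ?case by blast
  qed
qed

text \<open>This is the fixed vector lemma for \<open>U\<close> acting by right translation on the
  image of the group algebra. Translating by the inverse turns this into a left action.\<close>

lemma invariant_group_op_exists:
  "\<exists>a. group_op a \<noteq> (\<lambda>x. 0) \<and> (\<forall>u\<in>UU. \<forall>x. group_op a (\<rho> u x) = group_op a x)"
proof -
  define scf :: "'f \<Rightarrow> ('v \<Rightarrow> 'v) \<Rightarrow> 'v \<Rightarrow> 'v" where "scf = (\<lambda>c f x. sc c (f x))"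
  interpret F: vector_space scf
    by unfold_locales (auto simp: scf_def fun_eq_iff V.scale_right_distrib V.scale_left_distrib)
  interpret G: group G by (rule group_G)
  have iG: "inv\<^bsub>G\<^esub> g \<in> carrier G" if "g \<in> carrier G" for g using that by simp
  have inv: "g ** inv\<^bsub>G\<^esub> g = mat 1" "inv\<^bsub>G\<^esub> g ** g = mat 1" if "g \<in> carrier G" for g
    using G.r_inv[OF that] G.l_inv[OF that] by simp_all
  define r :: "'q^4^4 \<Rightarrow> ('v \<Rightarrow> 'v) \<Rightarrow> 'v \<Rightarrow> 'v" where "r = (\<lambda>g f x. f (\<rho> (inv\<^bsub>G\<^esub> g) x))"
  have "\<exists>f\<in>range group_op. f \<noteq> 0 \<and> (\<forall>a b. r (S a b) f = f)"
  proof (rule unipotent_fixed_vector[OF char2 F.vector_space_axioms])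
    show "F.subspace (range group_op)"
      unfolding F.subspace_def
    proof safe
      show "0 \<in> range group_op" 
        by (rule image_eqI[of _ _ "\<lambda>g. 0"]) (simp_all add: fun_eq_iff group_op_0)
      show "group_op a + group_op b \<in> range group_op" for a b
        by (rule image_eqI[of _ _ "\<lambda>g. a g + b g"]) (simp_all add: fun_eq_iff group_op_add)
      show "scf c (group_op a) \<in> range group_op" for a c
        by (rule image_eqI[of _ _ "\<lambda>g. c * a g"]) (simp_all add: fun_eq_iff group_op_scale scf_def)
    qed
    show "range group_op \<noteq> {0}"
    proof
      assume *: "range group_op = {0}"
      obtain x :: 'v where "x \<noteq> 0" using nonzero by blast
      moreover have "group_op (\<lambda>g. if g = mat 1 then 1 else 0) x = x"
        using group_op_single[of "mat 1" x] by simp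
      moreover have "group_op (\<lambda>g. if g = mat 1 then 1 else 0) = 0" using * by blast
      ultimately show False by simp
    qed
    show "Vector_Spaces.linear scf scf (r (S a b))" for a b
      by (rule linear_scaleI[OF F.vector_space_axioms F.vector_space_axioms])
         (simp_all add: r_def scf_def fun_eq_iff)
    show "r (S a b) f \<in> range group_op" if f: "f \<in> range group_op" for a b f
    proof -
      obtain c where c: "f = group_op c" using f by blast
      have "r (S a b) f = group_op (\<lambda>g. c (g ** S a b))"
        unfolding r_def c
        by (rule ext, rule group_op_right[symmetric]) (simp_all add: iG inv)
      thus ?thesis by simp
    qed
    show "r (S a b ** S c d) f = r (S a b) (r (S c d) f)" for a b c d f
      using G.inv_mult_group[of "S a b" "S c d"] by (simp add: r_def rho_mult)
    show "r (mat 1) f = f" for f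
      using G.inv_one by (simp add: r_def)
  qed
  then obtain a where a: "group_op a \<noteq> 0" "\<And>b c. r (S b c) (group_op a) = group_op a" by blast
  have "group_op a (\<rho> u x) = group_op a x" if u: "u \<in> UU" for u x
  proof -
    obtain b c where bc: "u = S b c" using u by (auto simp: UU_def)
    have "group_op a x = r (S b c) (group_op a) (\<rho> u x)"
      using u by (simp add: r_def bc inv iG flip: rho_mult)
    thus ?thesis by (simp add: a)
  qed
  thus ?thesis using a(1) by (auto simp: zero_fun_def)
qed

definition tr :: "('v \<Rightarrow> 'v) \<Rightarrow> 'f" where "tr = linear_trace sc B"

lemma tr_sum: "tr (\<lambda>x. \<Sum>i\<in>A. sc (c i) (f i x)) = (\<Sum>i\<in>A. c i * tr (f i))"
proof -
  have "tr (\<lambda>x. \<Sum>i\<in>A. sc (c i) (f i x)) = (\<Sum>b\<in>B. \<Sum>i\<in>A. c i * V.representation B (f i b) b)"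
    by (simp add: tr_def linear_trace_def V.representation_sum V.representation_scale
      V.independent_Basis V.span_Basis)
  also have "\<dots> = (\<Sum>i\<in>A. \<Sum>b\<in>B. c i * V.representation B (f i b) b)"
    by (rule sum.swap)
  finally show ?thesis by (simp add: tr_def linear_trace_def sum_distrib_left)
qed

lemma tr_rank_one:
  assumes "\<And>x y. \<phi> (x + y) = \<phi> x + \<phi> y" "\<And>c x. \<phi> (sc c x) = c * \<phi> x"
  shows "tr (\<lambda>x. sc (\<phi> x) z) = \<phi> z"
proof -
  have 0: "\<phi> 0 = 0" using assms(2)[of 0 0] by simp
  have s: "\<phi> (sum f A) = (\<Sum>i\<in>A. \<phi> (f i))" for f :: "'v \<Rightarrow> 'v" and A
    by (induction A rule: infinite_finite_induct) (simp_all add: 0 assms)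
  have "tr (\<lambda>x. sc (\<phi> x) z) = (\<Sum>b\<in>B. \<phi> b * V.representation B z b)"
    by (simp add: tr_def linear_trace_def V.representation_scale V.independent_Basis V.span_Basis)
  also have "\<dots> = \<phi> (\<Sum>b\<in>B. sc (V.representation B z b) b)"
    by (simp add: s assms mult.commute)
  also have "(\<Sum>b\<in>B. sc (V.representation B z b) b) = z"
    by (rule V.sum_representation_eq) (simp_all add: V.independent_Basis V.span_Basis V.finite_Basis)
  finally show ?thesis .
qed

text \<open>Let \<open>\<beta> = group_op a\<close> be nonzero at \<open>p\<close>. A
  \<open>U\<close>-invariant element of the image of the group algebra has rank one, say \<open>x
  \<mapsto> \<phi>(x) z\<close>. With group algebra elements \<open>\<gamma>\<close>,
  \<open>\<delta>\<close> that map \<open>z\<close> to \<open>p\<close> and \<open>\<beta>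
  p\<close> to a point where \<open>\<phi>\<close> is \<open>1\<close>, the product \<open>x
  \<mapsto> \<beta> (\<gamma> (\<phi>(\<delta> x) z))\<close> has trace \<open>\<phi>(\<delta>
  (\<beta> p)) = 1\<close>; but it is a combination of the \<open>\<beta> \<circ> \<rho>
  g\<close>.\<close>

lemma tr_nondegenerate:
  assumes "\<And>g. g \<in> carrier G \<Longrightarrow> tr (\<lambda>x. group_op a (\<rho> g x)) = 0"
  shows "group_op a p = 0"
proof (rule ccontr)
  assume p: "group_op a p \<noteq> 0"
  obtain \<eta> v where v: "highest_weight \<eta> v" and cyclic: "V.span {\<rho> u (\<rho> T v) | u. u \<in> UU} = UNIV"
    using cyclic_highest_weight_exists by blast
  obtain b where b: "group_op b \<noteq> (\<lambda>x. 0)" "\<And>u x. u \<in> UU \<Longrightarrow> group_op b (\<rho> u x) = group_op b x"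
    using invariant_group_op_exists by blast
  define y where "y = \<rho> T v"
  define z where "z = group_op b y"
  have ex: "\<exists>c. group_op b x = sc c z" for x
    unfolding z_def y_def by (rule coinvariants(2)[OF v cyclic group_op_linear b(2)])
  then obtain \<phi> where \<phi>: "\<And>x. group_op b x = sc (\<phi> x) z" by metis
  have z: "z \<noteq> 0"
  proof
    assume "z = 0"
    hence "group_op b x = 0" for x using \<phi> by simp
    thus False using b(1) by (simp add: fun_eq_iff)
  qed
  have \<phi>_eq: "\<phi> x = c" if "group_op b x = sc c z" for x c
    using that z by (simp add: \<phi>)
  have \<phi>_add: "\<phi> (x + y) = \<phi> x + \<phi> y" for x y
    by (rule \<phi>_eq) (simp add: group_op_simps \<phi> V.scale_left_distrib)
  have \<phi>_scale: "\<phi> (sc c x) = c * \<phi> x" for c x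
    by (rule \<phi>_eq) (simp add: group_op_simps \<phi>)
  obtain c where c: "group_op c z = p" using group_op_transitive[OF z] by blast
  obtain d where d: "group_op d (group_op a p) = y" using group_op_transitive[OF p] by blast
  obtain e where e: "\<And>x. group_op c (group_op b (group_op d x)) = group_op e x"
    using group_op_comp by metis
  have "tr (\<lambda>x. group_op a (group_op e x)) = tr (\<lambda>x. sc (\<phi> (group_op d x)) (group_op a p))"
    by (simp add: \<phi> c group_op_simps flip: e)
  also have "\<dots> = \<phi> (group_op d (group_op a p))"
    by (rule tr_rank_one) (simp_all add: group_op_simps \<phi>_add \<phi>_scale)
  also have "\<dots> = 1" unfolding d by (rule \<phi>_eq) (simp add: z_def)
  finally have "tr (\<lambda>x. group_op a (group_op e x)) = 1" .
  moreover have "tr (\<lambda>x. group_op a (group_op e x)) = 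
    tr (\<lambda>x. \<Sum>g\<in>carrier G. sc (e g) (group_op a (\<rho> g x)))"
    by (simp add: group_op_def[of e] group_op_simps)
  hence "tr (\<lambda>x. group_op a (group_op e x)) = 0"
    by (simp add: tr_sum assms)
  ultimately show False by simp
qed

end

section \<open>Traces in the prime field\<close>

locale suzuki_rep_F2 = suzuki_rep k Q sc B \<rho>
  for k :: nat and Q :: "'q::{finite,field} itself"
    and sc :: "'f::alg_closed_field \<Rightarrow> 'v::ab_group_add \<Rightarrow> 'v" and B :: "'v set"
    and \<rho> :: "'q^4^4 \<Rightarrow> 'v \<Rightarrow> 'v" +
  assumes trace_F2: "g \<in> carrier G \<Longrightarrow> linear_trace sc B (\<rho> g) \<in> {0, 1}"
    and faithful: "inj_on \<rho> (carrier G)"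
begin

lemma square_sum: "(\<Sum>i\<in>A. h i) ^ 2 = (\<Sum>i\<in>A. (h i) ^ 2 :: 'f)"
  by (rule freshmans_dream_sum) (simp_all add: char2)

lemma square_diff: "((x::'f) - y) ^ 2 = x ^ 2 - y ^ 2"
proof -
  have two: "2 = (0::'f)" using two_eq_0_f by (simp only: one_add_one)
  hence "y ^ 2 + y ^ 2 = 0" by (simp only: mult_2[symmetric] two mult_zero_left)
  hence neg: "- (y ^ 2) = y ^ 2" by (rule minus_unique)
  have "x ^ 2 - y ^ 2 = x ^ 2 + y ^ 2"
    by (subst diff_conv_add_uminus) (simp only: neg)
  thus ?thesis by (simp only: power2_diff two) simp
qed

text \<open>Both sides are sums over the group of coefficients times traces; squaring is additive
  and fixes the traces.\<close>

lemma tr_group_op_frobenius: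
  assumes h: "h \<in> carrier G"
  shows "tr (\<lambda>x. group_op (\<lambda>g. a g ^ 2) (\<rho> h x)) = tr (\<lambda>x. group_op a (\<rho> h x)) ^ 2"
proof -
  have *: "tr (\<lambda>x. group_op c (\<rho> h x)) = (\<Sum>g\<in>carrier G. c g * tr (\<rho> (g ** h)))" for c
  proof -
    have "tr (\<lambda>x. group_op c (\<rho> h x)) = tr (\<lambda>x. \<Sum>g\<in>carrier G. sc (c g) (\<rho> g (\<rho> h x)))"
      by (simp add: group_op_def)
    also have "\<dots> = (\<Sum>g\<in>carrier G. c g * tr (\<lambda>x. \<rho> g (\<rho> h x)))"
      by (rule tr_sum)
    also have "\<dots> = (\<Sum>g\<in>carrier G. c g * tr (\<rho> (g ** h)))"
    proof (intro sum.cong refl)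
      fix g assume "g \<in> carrier G"
      hence "(\<lambda>x. \<rho> g (\<rho> h x)) = \<rho> (g ** h)" using h by (simp add: rho_mult fun_eq_iff)
      thus "c g * tr (\<lambda>x. \<rho> g (\<rho> h x)) = c g * tr (\<rho> (g ** h))" by simp
    qed
    finally show ?thesis .
  qed
  have "(\<Sum>g\<in>carrier G. (a g)\<^sup>2 * tr (\<rho> (g ** h))) = (\<Sum>g\<in>carrier G. (a g * tr (\<rho> (g ** h))) ^ 2)"
  proof (intro sum.cong refl)
    fix g assume "g \<in> carrier G"
    hence "tr (\<rho> (g ** h)) \<in> {0, 1}" unfolding tr_def using h by (intro trace_F2) simp
    thus "(a g)\<^sup>2 * tr (\<rho> (g ** h)) = (a g * tr (\<rho> (g ** h)))\<^sup>2" by (auto simp: power2_eq_square)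
  qed
  thus ?thesis unfolding * by (simp add: square_sum)
qed

lemma group_op_frobenius_eq_0_iff:
  "(\<forall>x. group_op (\<lambda>g. a g ^ 2) x = 0) \<longleftrightarrow> (\<forall>x. group_op a x = 0)"
proof (intro iffI allI tr_nondegenerate)
  have 0: "tr (\<lambda>x. 0) = 0" by (simp add: tr_def linear_trace_def V.representation_zero)
  fix h assume h: "h \<in> carrier G"
  show "tr (\<lambda>x. group_op (\<lambda>g. a g ^ 2) (\<rho> h x)) = 0" if "\<forall>x. group_op a x = 0"
    unfolding tr_group_op_frobenius[OF h] using that 0 by simp
  show "tr (\<lambda>x. group_op a (\<rho> h x)) = 0" if "\<forall>x. group_op (\<lambda>g. a g ^ 2) x = 0"
    using tr_group_op_frobenius[OF h, of a] that 0 by simp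
qed

text \<open>Let \<open>\<alpha> = group_op a\<close> be \<open>U\<close>-invariant and nonzero.
  The equations \<open>\<alpha> u = \<alpha>\<close> and \<open>\<alpha> h = c \<alpha>\<close>
  say that certain elements of the group algebra act as zero, so they survive the Frobenius twist,
  with \<open>c\<close> replaced by \<open>c\<^sup>2\<close>. But all \<open>U\<close>-invariant
  maps transform under \<open>h\<close> by the same scalar.\<close>

lemma weight_trivial:
  assumes v: "highest_weight \<eta> v" and cyclic: "V.span {\<rho> u (\<rho> T v) | u. u \<in> UU} = UNIV"
    and l: "l \<noteq> 0"
  shows "\<rho> (M l) v = v"
proof -
  obtain a where a: "group_op a \<noteq> (\<lambda>x. 0)" "\<And>u x. u \<in> UU \<Longrightarrow> group_op a (\<rho> u x) = group_op a x"
    using invariant_group_op_exists by blast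
  define a2 where "a2 = (\<lambda>g. a g ^ 2)"
  have twist: "group_op a2 (\<rho> h x) = sc (c ^ 2) (group_op a2 x)"
    if h: "h \<in> carrier G" and c: "\<And>x. group_op a (\<rho> h x) = sc c (group_op a x)" for h c x
  proof -
    obtain h' where h': "h' \<in> carrier G" "h ** h' = mat 1" "h' ** h = mat 1"
      using G_inverse[OF h] by blast
    have "\<forall>x. group_op (\<lambda>g. a (g ** h') - c * a g) x = 0"
      by (simp add: group_op_diff group_op_scale group_op_right[OF h h'(2,3,1)] c)
    hence "\<forall>x. group_op (\<lambda>g. (a (g ** h') - c * a g) ^ 2) x = 0"
      by (rule iffD2[OF group_op_frobenius_eq_0_iff])
    hence "group_op (\<lambda>g. a2 (g ** h') - c ^ 2 * a2 g) x = 0"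
      by (simp add: square_diff power_mult_distrib a2_def)
    thus ?thesis
      by (simp add: group_op_diff group_op_scale group_op_right[OF h h'(2,3,1)])
  qed
  have inv: "group_op a2 (\<rho> u x) = group_op a2 x" if "u \<in> UU" for u x
    using twist[of u 1 x] a(2) that by simp
  have "\<not> (\<forall>x. group_op a2 x = 0)"
    unfolding a2_def group_op_frobenius_eq_0_iff using a(1) by (auto simp: fun_eq_iff)
  then obtain x where x: "group_op a2 x \<noteq> 0" by blast
  \<comment> \<open>coinvariants carry the inverse weight, so the torus element to test is \<open>M (inverse l)\<close>\<close>
  define c where "c = \<eta> (inverse (inverse l))"
  have il: "inverse l \<noteq> 0" using l by simp
  have "group_op a2 (\<rho> (M (inverse l)) x) = sc (c ^ 2) (group_op a2 x)"
    using coinvariants(1)[OF v cyclic group_op_linear a(2) il] il unfolding c_def by (intro twist) auto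
  moreover have "group_op a2 (\<rho> (M (inverse l)) x) = sc c (group_op a2 x)"
    using coinvariants(1)[OF v cyclic group_op_linear inv il] by (simp add: c_def)
  ultimately have "c ^ 2 = c" using x by simp
  moreover have "c = \<eta> l" by (simp add: c_def)
  moreover have "\<eta> l \<noteq> 0"
  proof
    assume "\<eta> l = 0"
    hence "\<rho> (M l) v = 0" using v l by (simp add: highest_weight_def)
    hence "\<rho> (M l) v = \<rho> (M l) 0" using l by (simp add: rho_simps)
    hence "v = 0" using l by (simp add: inj_eq[OF bij_is_inj[OF rho_bij]])
    thus False using v by (simp add: highest_weight_def)
  qed
  ultimately have "\<eta> l = 1" by (simp add: power2_eq_square)
  thus ?thesis using v l by (simp add: highest_weight_def)
qed

lemma P_fixed_vector: "\<exists>v. v \<noteq> 0 \<and> (\<forall>p\<in>P. \<rho> p v = v)"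
proof -
  obtain \<eta> v where v: "highest_weight \<eta> v" and cyclic: "V.span {\<rho> u (\<rho> T v) | u. u \<in> UU} = UNIV"
    using cyclic_highest_weight_exists by blast
  have "\<rho> p v = v" if p: "p \<in> P" for p
  proof -
    obtain u l where "p = u ** M l" "u \<in> UU" "l \<noteq> 0" using p by (auto simp: P_eq UU_def)
    thus ?thesis using v weight_trivial[OF v cyclic, of l] by (simp add: rho_mult highest_weight_def)
  qed
  thus ?thesis using v by (auto simp: highest_weight_def)
qed

end

section \<open>The Steinberg representation\<close>

lemma vector_space_fun_scale: "vector_space (fun_scale :: 'f::field \<Rightarrow> ('x \<Rightarrow> 'f) \<Rightarrow> _)"
  by unfold_locales (auto simp: fun_scale_def fun_eq_iff algebra_simps)

context suzuki begin

lemma l_coset_eq_image: "g <#\<^bsub>G\<^esub> x = (**) g ` x"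
  by (auto simp: l_coset_def)

lemma l_coset_mult: "g <#\<^bsub>G\<^esub> (h <#\<^bsub>G\<^esub> x) = (g ** h) <#\<^bsub>G\<^esub> x"
  by (simp add: l_coset_eq_image image_image matrix_mul_assoc)

lemma l_coset_1: "mat 1 <#\<^bsub>G\<^esub> x = x"
  by (simp add: l_coset_eq_image)

abbreviation "Cosets \<equiv> (lcosets\<^bsub>G\<^esub> P)"

lemma Cosets_eq: "Cosets = (\<lambda>g. g <#\<^bsub>G\<^esub> P) ` carrier G"
  by (auto simp: LCOSETS_def)

lemma l_coset_Cosets: "g \<in> carrier G \<Longrightarrow> x \<in> Cosets \<Longrightarrow> g <#\<^bsub>G\<^esub> x \<in> Cosets"
  by (auto simp: Cosets_eq l_coset_mult)

lemma l_coset_P_eq_iff: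
  assumes "g \<in> carrier G" "h ** g = mat 1" "g ** h = mat 1"
  shows "g' <#\<^bsub>G\<^esub> P = g <#\<^bsub>G\<^esub> P \<longleftrightarrow> h ** g' \<in> P"
proof
  have 1: "mat 1 \<in> P" using P_gens(1)[of 0 0] by (simp add: S_0_0)
  assume "g' <#\<^bsub>G\<^esub> P = g <#\<^bsub>G\<^esub> P"
  moreover have "g' \<in> g' <#\<^bsub>G\<^esub> P" using 1 by (force simp: l_coset_eq_image)
  ultimately obtain p where "p \<in> P" "g' = g ** p" by (auto simp: l_coset_eq_image)
  thus "h ** g' \<in> P" using assms by (simp add: matrix_mul_assoc)
next
  assume p: "h ** g' \<in> P"
  have "g ** (h ** g') = g'" using assms by (simp add: matrix_mul_assoc)
  hence "g' <#\<^bsub>G\<^esub> P = g <#\<^bsub>G\<^esub> ((h ** g') <#\<^bsub>G\<^esub> P)"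
    by (simp add: l_coset_mult)
  also have "(h ** g') <#\<^bsub>G\<^esub> P = P"
    using group.coset_join3[OF group_G _ subgroup_P p] p subgroup.mem_carrier[OF subgroup_P] by simp
  finally show "g' <#\<^bsub>G\<^esub> P = g <#\<^bsub>G\<^esub> P" .
qed

lemma P_in_Cosets: "P \<in> Cosets"
  unfolding Cosets_eq using l_coset_1[of P] by (metis in_G(4) imageI)

text \<open>By the Bruhat decomposition these are the cosets other than \<open>P\<close>, each for
  exactly one \<open>u\<close> in \<open>U\<close>.\<close>

definition big_cell :: "'q^4^4 \<Rightarrow> ('q^4^4) set" where "big_cell u = (u ** T) <#\<^bsub>G\<^esub> P"

lemma big_cell_in_Cosets: "u \<in> UU \<Longrightarrow> big_cell u \<in> Cosets"
  using UU_in_G by (auto simp: Cosets_eq big_cell_def)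

lemma big_cell_l_coset: "w <#\<^bsub>G\<^esub> big_cell u = big_cell (w ** u)"
  by (simp add: big_cell_def l_coset_mult matrix_mul_assoc)

lemma Cosets_bruhat: "Cosets = insert P (big_cell ` UU)"
proof
  show "Cosets \<subseteq> insert P (big_cell ` UU)"
  proof
    fix x assume "x \<in> Cosets"
    then obtain g where g: "g \<in> carrier G" "x = g <#\<^bsub>G\<^esub> P" by (auto simp: Cosets_eq)
    have p: "p <#\<^bsub>G\<^esub> P = P" if "p \<in> P" for p
      using group.coset_join3[OF group_G _ subgroup_P that] that subgroup.mem_carrier[OF subgroup_P] by simp
    from g(1) show "x \<in> insert P (big_cell ` UU)"
    proof (cases rule: bruhat)
      case 1
      thus ?thesis by (simp add: g p)
    next
      case (2 a b q)
      have "x = S a b <#\<^bsub>G\<^esub> (T <#\<^bsub>G\<^esub> (q <#\<^bsub>G\<^esub> P))" by (simp add: g 2 l_coset_mult)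
      also have "\<dots> = big_cell (S a b)" using 2 by (simp add: p big_cell_def l_coset_mult)
      finally show ?thesis by (auto simp: UU_def)
    qed
  qed
  show "insert P (big_cell ` UU) \<subseteq> Cosets"
    using P_in_Cosets big_cell_in_Cosets by auto
qed

lemma P_neq_big_cell: 
  assumes u: "u \<in> UU" shows "P \<noteq> big_cell u"
proof
  assume "P = big_cell u"
  hence "(u ** T) <#\<^bsub>G\<^esub> P = mat 1 <#\<^bsub>G\<^esub> P" by (simp add: big_cell_def l_coset_1)
  hence "u ** T \<in> P" using l_coset_P_eq_iff[of "mat 1" "mat 1" "u ** T"] by simp
  moreover obtain u' where "u' \<in> UU" "u' ** u = mat 1" using UU_inverse[OF u] by blast
  ultimately have "u' ** (u ** T) \<in> P" using UU_subset_P P_mult by blast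
  thus False using \<open>u' ** u = mat 1\<close> T_notin_P by (simp add: matrix_mul_assoc)
qed

lemma inj_big_cell: "inj_on big_cell UU"
proof
  fix u w assume u: "u \<in> UU" and w: "w \<in> UU" and eq: "big_cell u = big_cell w"
  obtain w' where w': "w' \<in> UU" "w' ** w = mat 1" "w ** w' = mat 1" using UU_inverse[OF w] by blast
  have "T ** (w' ** u) ** T = (T ** w') ** (u ** T)" by (simp add: matrix_mul_assoc)
  moreover have "(T ** w') ** (w ** T) = T ** ((w' ** w) ** T)" "(w ** T) ** (T ** w') = w ** ((T ** T) ** w')"
    by (simp_all only: matrix_mul_assoc)
  hence "(T ** w') ** (w ** T) = mat 1" "(w ** T) ** (T ** w') = mat 1" 
    using w' by (simp_all add: T_T)
  hence "(T ** w') ** (u ** T) \<in> P"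
    using eq l_coset_P_eq_iff[of "w ** T" "T ** w'" "u ** T"] w UU_in_G by (auto simp: big_cell_def)
  ultimately have "T ** (w' ** u) ** T \<in> P" by simp
  moreover obtain a b where ab: "w' ** u = S a b" using UU_mult[OF w'(1) u] by (auto simp: UU_def)
  ultimately have "w' ** u = mat 1" using T_S_T_in_P_iff S_0_0 by simp
  hence "w ** (w' ** u) = w" by simp
  thus "u = w" using w' by (simp add: matrix_mul_assoc)
qed

lemma sum_Cosets: "(\<Sum>x\<in>Cosets. f x) = f P + (\<Sum>u\<in>UU. f (big_cell u))"
proof -
  have "P \<notin> big_cell ` UU" using P_neq_big_cell by blast
  thus ?thesis by (simp add: Cosets_bruhat sum.reindex[OF inj_big_cell])
qed

lemma inv_G: "g \<in> carrier G \<Longrightarrow> inv\<^bsub>G\<^esub> g \<in> carrier G" "g \<in> carrier G \<Longrightarrow> g ** inv\<^bsub>G\<^esub> g = mat 1"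
  "g \<in> carrier G \<Longrightarrow> inv\<^bsub>G\<^esub> g ** g = mat 1"
  using group.inv_closed[OF group_G] group.r_inv[OF group_G] group.l_inv[OF group_G] by simp_all

lemma sum_Cosets_l_coset:
  assumes "g \<in> carrier G"
  shows "(\<Sum>x\<in>Cosets. f (g <#\<^bsub>G\<^esub> x)) = (\<Sum>x\<in>Cosets. f x)"
  by (rule sum.reindex_bij_witness[of _ "\<lambda>x. inv\<^bsub>G\<^esub> g <#\<^bsub>G\<^esub> x" "\<lambda>x. g <#\<^bsub>G\<^esub> x"])
     (auto simp: l_coset_mult l_coset_1 inv_G assms l_coset_Cosets)

lemma Cosets_l_coset_iff:
  assumes "g \<in> carrier G"
  shows "g <#\<^bsub>G\<^esub> x \<in> Cosets \<longleftrightarrow> x \<in> Cosets"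
proof
  assume "g <#\<^bsub>G\<^esub> x \<in> Cosets"
  hence "inv\<^bsub>G\<^esub> g <#\<^bsub>G\<^esub> (g <#\<^bsub>G\<^esub> x) \<in> Cosets" using inv_G assms l_coset_Cosets by blast
  thus "x \<in> Cosets" using assms by (simp add: l_coset_mult inv_G l_coset_1)
qed (rule l_coset_Cosets[OF assms])

lemma steinberg_action_linear:
  "Vector_Spaces.linear fun_scale fun_scale (steinberg_action k g :: (('q^4^4) set \<Rightarrow> 'f::field) \<Rightarrow> _)"
  by (rule linear_scaleI[OF vector_space_fun_scale vector_space_fun_scale])
     (auto simp: steinberg_action_def fun_scale_def fun_eq_iff)

lemma steinberg_action_closed:
  assumes "g \<in> carrier G" "h \<in> steinberg_space k"
  shows "steinberg_action k g h \<in> steinberg_space k"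
  using assms inv_G(1)[OF assms(1)]
  by (auto simp: steinberg_space_def steinberg_action_def Cosets_l_coset_iff 
      sum_Cosets_l_coset[OF inv_G(1)[OF assms(1)]])

lemma steinberg_action_mult:
  assumes "g \<in> carrier G" "h \<in> carrier G"
  shows "steinberg_action k (g ** h) f = steinberg_action k g (steinberg_action k h f)"
  using group.inv_mult_group[OF group_G assms]
  by (simp add: steinberg_action_def fun_eq_iff l_coset_mult)

lemma steinberg_action_1: "steinberg_action k (mat 1 :: 'q^4^4) f = f"
  using monoid.inv_one[OF group.is_monoid[OF group_G]]
  by (simp add: steinberg_action_def fun_eq_iff l_coset_1)

lemma subspace_steinberg: "module.subspace fun_scale (steinberg_space k :: (('q^4^4) set \<Rightarrow> 'f::field) set)"
proof -
  interpret F: vector_space "fun_scale :: 'f \<Rightarrow> (('q^4^4) set \<Rightarrow> 'f) \<Rightarrow> _" by (rule vector_space_fun_scale)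
  show ?thesis
    unfolding F.subspace_def
    by (auto simp: steinberg_space_def fun_scale_def sum.distrib simp flip: sum_distrib_left)
qed

end

locale suzuki_rep_P_fixed = suzuki_rep k Q sc B \<rho>
  for k :: nat and Q :: "'q::{finite,field} itself"
    and sc :: "'f::alg_closed_field \<Rightarrow> 'v::ab_group_add \<Rightarrow> 'v" and B :: "'v set"
    and \<rho> :: "'q^4^4 \<Rightarrow> 'v \<Rightarrow> 'v" +
  fixes v :: 'v
  assumes faithful: "inj_on \<rho> (carrier G)"
    and v_nonzero: "v \<noteq> 0" and P_fixed: "p \<in> P \<Longrightarrow> \<rho> p v = v"
begin

abbreviation steinberg :: "(('q^4^4) set \<Rightarrow> 'f) set" where "steinberg \<equiv> steinberg_space k"

interpretation St: vector_space "fun_scale :: 'f \<Rightarrow> (('q^4^4) set \<Rightarrow> 'f) \<Rightarrow> _"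
  by (rule vector_space_fun_scale)

text \<open>The vector \<open>g v\<close> for the coset \<open>g P\<close>; it does not depend on
  the choice of \<open>g\<close> because \<open>P\<close> fixes \<open>v\<close>.\<close>

definition orbit_pt :: "('q^4^4) set \<Rightarrow> 'v" where "orbit_pt x = \<rho> (SOME g. g \<in> x) v"

lemma orbit_pt: 
  assumes g: "g \<in> carrier G" shows "orbit_pt (g <#\<^bsub>G\<^esub> P) = \<rho> g v"
proof -
  have "\<exists>h. h \<in> g <#\<^bsub>G\<^esub> P" using P_gens by (auto simp: l_coset_eq_image)
  hence "(SOME h. h \<in> g <#\<^bsub>G\<^esub> P) \<in> g <#\<^bsub>G\<^esub> P" by (rule someI_ex)
  then obtain p where "p \<in> P" "(SOME h. h \<in> g <#\<^bsub>G\<^esub> P) = g ** p" by (auto simp: l_coset_eq_image)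
  thus ?thesis
    using P_fixed g subgroup.mem_carrier[OF subgroup_P] by (simp add: orbit_pt_def rho_mult)
qed

lemma orbit_pt_l_coset:
  assumes "g \<in> carrier G" "x \<in> Cosets"
  shows "orbit_pt (g <#\<^bsub>G\<^esub> x) = \<rho> g (orbit_pt x)"
  using assms by (auto simp: Cosets_eq l_coset_mult orbit_pt rho_mult)

lemma orbit_pt_P: "orbit_pt P = v"
  using orbit_pt[of "mat 1"] by (simp add: l_coset_1)

definition orbit_map :: "(('q^4^4) set \<Rightarrow> 'f) \<Rightarrow> 'v" where
  "orbit_map h = (\<Sum>x\<in>Cosets. sc (h x) (orbit_pt x))"

lemma orbit_map_linear: "Vector_Spaces.linear fun_scale sc orbit_map"
  by (rule linear_scaleI[OF vector_space_fun_scale V.vector_space_axioms])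
     (simp_all add: orbit_map_def fun_scale_def V.scale_left_distrib sum.distrib V.scale_sum_right)

lemmas orbit_map_simps = linear_simps[OF orbit_map_linear]

lemma orbit_map_equivariant:
  assumes g: "g \<in> carrier G"
  shows "orbit_map (steinberg_action k g h) = \<rho> g (orbit_map h)"
proof -
  have "orbit_map (steinberg_action k g h) = 
    (\<Sum>x\<in>Cosets. sc (steinberg_action k g h (g <#\<^bsub>G\<^esub> x)) (orbit_pt (g <#\<^bsub>G\<^esub> x)))"
    unfolding orbit_map_def by (rule sum_Cosets_l_coset[OF g, symmetric])
  also have "\<dots> = (\<Sum>x\<in>Cosets. sc (h x) (\<rho> g (orbit_pt x)))"
    by (intro sum.cong refl) 
       (simp add: orbit_pt_l_coset g steinberg_action_def l_coset_mult inv_G l_coset_1)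
  also have "\<dots> = \<rho> g (orbit_map h)"
    by (simp add: orbit_map_def rho_simps g)
  finally show ?thesis .
qed

text \<open>The invariants form a subrepresentation, and the group does not act trivially on the
  whole space.\<close>

lemma no_invariants:
  assumes "\<And>g. g \<in> carrier G \<Longrightarrow> \<rho> g x = x"
  shows "x = 0"
proof (rule ccontr)
  assume x: "x \<noteq> 0"
  let ?W = "{y. \<forall>g\<in>carrier G. \<rho> g y = y}"
  have "?W = {0} \<or> ?W = UNIV"
    by (rule irreducible) (auto simp: V.subspace_def rho_simps)
  moreover have "x \<in> ?W" using assms by simp
  ultimately have W: "?W = UNIV" using x by blast
  have "\<rho> T = \<rho> (mat 1)" using W by (auto simp: fun_eq_iff)
  hence "T = mat 1" using faithful by (simp add: inj_on_eq_iff)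
  thus False using T_notin_P P_gens(1)[of 0 0] by (simp add: S_0_0)
qed

text \<open>A nonzero kernel has a nonzero \<open>U\<close>-fixed element \<open>f\<close>. It is
  constant on the \<open>q\<^sup>2\<close> cosets other than \<open>P\<close>, and its sum is
  zero, so \<open>f P = 0\<close>. Hence the points of the orbit other than \<open>v\<close> add
  up to zero, \<open>v\<close> is the sum over the whole orbit, and \<open>v\<close> is
  invariant.\<close>

lemma orbit_map_eq_0:
  assumes h: "h \<in> steinberg" "orbit_map h = 0"
  shows "h = 0"
proof (rule ccontr)
  assume h0: "h \<noteq> 0"
  define K where "K = {h \<in> steinberg. orbit_map h = 0}"
  have "St.subspace K"
    using subspace_steinberg[where 'f = 'f] unfolding K_def St.subspace_def
    by (auto simp: orbit_map_simps)
  moreover have "K \<noteq> {0}" using h h0 by (auto simp: K_def)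
  moreover have "steinberg_action k (S a b) f \<in> K" if "f \<in> K" for a b f
    using that by (auto simp: K_def steinberg_action_closed orbit_map_equivariant rho_simps)
  ultimately obtain f where f: "f \<in> K" "f \<noteq> 0" and inv: "\<And>a b. steinberg_action k (S a b) f = f"
    using unipotent_fixed_vector[OF char2 vector_space_fun_scale, of K "steinberg_action k"]
      steinberg_action_linear steinberg_action_mult steinberg_action_1 by (metis in_G(1))
  define c where "c = f (big_cell (mat 1))"
  have big: "f (big_cell u) = c" if u: "u \<in> UU" for u
  proof -
    have "steinberg_action k u f (big_cell u) = c"
      using u by (simp add: steinberg_action_def big_cell_l_coset inv_G c_def)
    moreover have "steinberg_action k u f = f" using u inv by (auto simp: UU_def)
    ultimately show ?thesis by simp
  qed
  have card: "(of_nat (card UU) :: 'f) = 0"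
  proof -
    have "even (card UU)" by (simp add: card_UU card_field)
    thus ?thesis by (metis char2 of_nat_eq_0_iff_char_dvd)
  qed
  have "(\<Sum>x\<in>Cosets. f x) = 0" using f by (simp add: K_def steinberg_space_def)
  hence fP: "f P = 0" by (simp add: sum_Cosets big card)
  have "c \<noteq> 0"
  proof
    assume "c = 0"
    hence "f x = 0" for x
      using f(1) big fP by (cases "x \<in> Cosets") (auto simp: K_def steinberg_space_def Cosets_bruhat)
    thus False using f(2) by auto
  qed
  have "0 = orbit_map f" using f by (simp add: K_def)
  also have "\<dots> = sc c (\<Sum>u\<in>UU. orbit_pt (big_cell u))"
    by (simp add: orbit_map_def sum_Cosets fP big V.scale_sum_right)
  finally have "(\<Sum>u\<in>UU. orbit_pt (big_cell u)) = 0" using \<open>c \<noteq> 0\<close> by simp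
  hence total: "(\<Sum>x\<in>Cosets. orbit_pt x) = v" by (simp add: sum_Cosets orbit_pt_P)
  have "\<rho> g v = v" if g: "g \<in> carrier G" for g
  proof -
    have "\<rho> g (\<Sum>x\<in>Cosets. orbit_pt x) = (\<Sum>x\<in>Cosets. orbit_pt (g <#\<^bsub>G\<^esub> x))"
      using g by (simp add: rho_simps orbit_pt_l_coset)
    also have "\<dots> = (\<Sum>x\<in>Cosets. orbit_pt x)" by (rule sum_Cosets_l_coset[OF g])
    finally show ?thesis by (simp add: total)
  qed
  hence "v = 0" by (rule no_invariants)
  thus False using v_nonzero by simp
qed

lemma orbit_map_inj: "inj_on orbit_map steinberg"
proof
  fix f h assume fh: "f \<in> steinberg" "h \<in> steinberg" "orbit_map f = orbit_map h"
  hence "f - h \<in> steinberg" using St.subspace_diff[OF subspace_steinberg] by blast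
  hence "f - h = 0" using fh by (intro orbit_map_eq_0) (simp_all add: orbit_map_simps)
  thus "f = h" by simp
qed

text \<open>The unique function in the Steinberg space with prescribed values on the cosets other
  than \<open>P\<close>.\<close>

definition extend :: "('q^4^4 \<Rightarrow> 'f) \<Rightarrow> ('q^4^4) set \<Rightarrow> 'f" where
  "extend c x = (if x = P then - (\<Sum>u\<in>UU. c u) 
     else if x \<in> big_cell ` UU then c (the_inv_into UU big_cell x) else 0)"

lemma extend_big_cell: "u \<in> UU \<Longrightarrow> extend c (big_cell u) = c u"
  using P_neq_big_cell[of u] by (auto simp: extend_def the_inv_into_f_f[OF inj_big_cell])

lemma extend_in: "extend c \<in> steinberg"
proof -
  have "extend c P = - (\<Sum>u\<in>UU. c u)" by (simp add: extend_def)
  thus ?thesis by (auto simp: steinberg_space_def sum_Cosets extend_big_cell) 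
      (auto simp: Cosets_bruhat extend_def)
qed

text \<open>The image of the difference of the indicator functions of \<open>big_cell u\<close>
  and \<open>P\<close>.\<close>

definition cell_vector :: "'q^4^4 \<Rightarrow> 'v" where "cell_vector u = \<rho> (u ** T) v - v"

lemma orbit_map_cell_vector:
  assumes "h \<in> steinberg"
  shows "orbit_map h = (\<Sum>u\<in>UU. sc (h (big_cell u)) (cell_vector u))"
proof -
  have "(\<Sum>x\<in>Cosets. h x) = 0" using assms by (simp add: steinberg_space_def)
  hence hP: "h P = - (\<Sum>u\<in>UU. h (big_cell u))" by (simp add: sum_Cosets eq_neg_iff_add_eq_0)
  show ?thesis
    by (simp add: orbit_map_def sum_Cosets hP orbit_pt_P cell_vector_def V.scale_right_diff_distrib 
      sum_subtractf V.scale_minus_left V.scale_sum_left big_cell_def orbit_pt)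
qed

lemma orbit_map_extend: "orbit_map (extend c) = (\<Sum>u\<in>UU. sc (c u) (cell_vector u))"
  by (simp add: orbit_map_cell_vector[OF extend_in] extend_big_cell)

lemma cell_vectors_independent:
  assumes "(\<Sum>u\<in>UU. sc (c u) (cell_vector u)) = 0" "u \<in> UU"
  shows "c u = 0"
proof -
  have "extend c = 0" by (rule orbit_map_eq_0[OF extend_in]) (simp add: orbit_map_extend assms)
  thus ?thesis using extend_big_cell[OF assms(2), of c] by simp
qed

lemma orbit_map_surj: "orbit_map ` steinberg = UNIV"
proof -
  let ?W = "orbit_map ` steinberg"
  have "?W = {0} \<or> ?W = UNIV"
  proof (rule irreducible)
    interpret om: Vector_Spaces.linear fun_scale sc orbit_map by (rule orbit_map_linear)
    show "V.subspace ?W" by (rule om.subspace_image[OF subspace_steinberg])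
    show "\<rho> g x \<in> ?W" if "g \<in> carrier G" "x \<in> ?W" for g x
      using that by (auto simp: steinberg_action_closed simp flip: orbit_map_equivariant)
  qed
  moreover have "?W \<noteq> {0}"
  proof
    assume "?W = {0}"
    hence "orbit_map (extend (\<lambda>u. 1)) = 0" using extend_in by blast
    hence "extend (\<lambda>u. 1) = 0" by (intro orbit_map_eq_0 extend_in)
    thus False using extend_big_cell[OF one_in_UU, of "\<lambda>u. 1"] by simp
  qed
  ultimately show ?thesis by blast
qed

text \<open>The vectors \<open>cell_vector u\<close> form a basis, being the images of a basis of
  the Steinberg space.\<close>

theorem dim_eq: "V.dim (UNIV :: 'v set) = CARD('q) ^ 2"
proof -
  have inj: "inj_on cell_vector UU"
  proof
    fix u w assume u: "u \<in> UU" and w: "w \<in> UU" and eq: "cell_vector u = cell_vector w"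
    have 1: "(\<Sum>t\<in>UU. sc ((if t = x then 1 else 0)) (cell_vector t)) = cell_vector x" if "x \<in> UU" for x
    proof -
      have "(\<Sum>t\<in>UU. sc ((if t = x then 1 else 0)) (cell_vector t)) = (\<Sum>t\<in>UU. if t = x then cell_vector t else 0)"
        by (intro sum.cong) auto
      thus ?thesis using that by simp
    qed
    have "(\<Sum>t\<in>UU. sc ((if t = u then 1 else 0) - (if t = w then 1 else 0)) (cell_vector t)) = 0"
      by (simp only: V.scale_left_diff_distrib sum_subtractf 1 u w eq diff_self)
    from cell_vectors_independent[OF this u] show "u = w" by (simp split: if_splits)
  qed
  have "V.independent (cell_vector ` UU)"
  proof (rule V.independent_if_scalars_zero)
    fix c x assume c: "(\<Sum>x\<in>cell_vector ` UU. sc (c x) x) = 0" and x: "x \<in> cell_vector ` UU"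
    have "(\<Sum>u\<in>UU. sc (c (cell_vector u)) (cell_vector u)) = 0"
      using c by (simp add: sum.reindex[OF inj])
    thus "c x = 0" using cell_vectors_independent[of "\<lambda>u. c (cell_vector u)"] x by blast
  qed simp
  moreover have "x \<in> V.span (cell_vector ` UU)" for x
  proof -
    obtain h where h: "h \<in> steinberg" "x = orbit_map h" using orbit_map_surj by (metis UNIV_I imageE)
    show ?thesis
      unfolding h(2) orbit_map_cell_vector[OF h(1)]
      by (intro V.span_sum V.span_scale V.span_base imageI)
  qed
  hence "V.span (cell_vector ` UU) = V.span UNIV" by auto
  ultimately have "V.dim (UNIV :: 'v set) = card (cell_vector ` UU)"
    by (intro V.dim_eq_card)
  also have "\<dots> = CARD('q) ^ 2" by (simp add: card_image[OF inj] card_UU)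
  finally show ?thesis .
qed

theorem isomorphic_steinberg:
  "isomorphic_reps G sc UNIV \<rho> fun_scale steinberg (steinberg_action k)"
proof -
  define \<psi> where "\<psi> = the_inv_into steinberg orbit_map"
  have bij: "bij_betw orbit_map steinberg UNIV"
    using orbit_map_inj orbit_map_surj by (simp add: bij_betw_def)
  have \<psi>_in: "\<psi> x \<in> steinberg" and om: "orbit_map (\<psi> x) = x" for x
    unfolding \<psi>_def using the_inv_into_into[OF orbit_map_inj, of x steinberg] 
      f_the_inv_into_f_bij_betw[OF bij] orbit_map_surj by auto
  have eq: "\<psi> x = h" if "h \<in> steinberg" "orbit_map h = x" for x h
    using that \<psi>_in om orbit_map_inj by (metis inj_onD)
  have "bij_betw \<psi> UNIV steinberg"
    unfolding \<psi>_def by (rule bij_betw_the_inv_into[OF bij])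
  moreover have "\<psi> (x + y) = \<psi> x + \<psi> y" for x y
    by (rule eq) (auto simp: orbit_map_simps om \<psi>_in intro!: St.subspace_add[OF subspace_steinberg])
  moreover have "\<psi> (sc c x) = fun_scale c (\<psi> x)" for c x
    by (rule eq) (auto simp: orbit_map_simps om \<psi>_in intro!: St.subspace_scale[OF subspace_steinberg])
  moreover have "\<psi> (\<rho> g x) = steinberg_action k g (\<psi> x)" if "g \<in> carrier G" for g x
    by (rule eq) (simp_all add: steinberg_action_closed that orbit_map_equivariant om \<psi>_in)
  ultimately show ?thesis unfolding isomorphic_reps_def by blast
qed

end

section \<open>Absolute irreducibility over an algebraically closed field\<close>

text \<open>An element algebraic over an algebraically closed field is a root of one of the linear
  factors of its equation.\<close>

lemma surj_to_ac: "surj (to_ac :: 'f::alg_closed_field \<Rightarrow> 'f alg_closure)"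
proof -
  have "x \<in> range to_ac" for x :: "'f alg_closure"
  proof -
    obtain p :: "'f poly" where p: "p \<noteq> 0" "poly (map_poly to_ac p) x = 0"
      using alg_closure_algebraic by blast
    thus ?thesis
    proof (induction "degree p" arbitrary: p)
      case 0
      then obtain a where "p = [:a:]" "a \<noteq> 0" by (metis degree_eq_zeroE pCons_eq_0_iff)
      with 0 show ?case by (simp add: map_poly_pCons)
    next
      case (Suc n)
      obtain r where "poly p r = 0"
        using alg_closed_imp_poly_has_root[of p] Suc by auto
      then obtain q where pq: "p = [:-r, 1:] * q"
        unfolding poly_eq_0_iff_dvd by (elim dvdE)
      hence q: "q \<noteq> 0" using Suc by auto
      hence deg: "n = degree q"
        using Suc(2) by (subst (asm) pq, subst (asm) degree_mult_eq) auto
      have "map_poly to_ac p = [:- to_ac r, 1:] * map_poly to_ac q"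
        unfolding pq by (intro poly_eqI) (auto simp: coeff_map_poly coeff_pCons split: nat.splits)
      hence "poly (map_poly to_ac p) x = poly [:- to_ac r, 1:] x * poly (map_poly to_ac q) x"
        by (simp only: poly_mult)
      hence "x = to_ac r \<or> poly (map_poly to_ac q) x = 0" using Suc.prems by simp
      thus ?case using Suc.hyps(1)[OF deg q] by blast
    qed
  qed
  thus ?thesis by blast
qed

lemma to_of_ac: "to_ac (of_ac x) = (x :: 'f::alg_closed_field alg_closure)"
  using surj_to_ac by (intro to_ac_of_ac) auto

lemma of_ac_add: "of_ac (x + y) = of_ac x + (of_ac y :: 'f::alg_closed_field)"
  by (rule of_ac_eqI) (simp add: to_of_ac)

lemma of_ac_mult: "of_ac (x * y) = of_ac x * (of_ac y :: 'f::alg_closed_field)"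
  by (rule of_ac_eqI) (simp add: to_of_ac)

lemma of_ac_sum: "of_ac (sum h A) = (\<Sum>a\<in>A. of_ac (h a) :: 'f::alg_closed_field)"
  by (induction A rule: infinite_finite_induct) (simp_all add: of_ac_add)

text \<open>As \<open>to_ac\<close> is bijective, the map \<open>D\<close> below identifies the
  extended space with \<open>V\<close>, semilinearly and equivariantly, and subrepresentations of
  \<open>V\<close> can be pulled back along it.\<close>

lemma absolutely_irreducible_imp_irreducible:
  fixes sc :: "'f::alg_closed_field \<Rightarrow> 'v::ab_group_add \<Rightarrow> 'v"
  assumes fd: "finite_dimensional_vector_space sc B"
    and irr: "absolutely_irreducible_rep Gr sc B \<rho>"
    and lin: "\<And>g. g \<in> carrier Gr \<Longrightarrow> Vector_Spaces.linear sc sc (\<rho> g)"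
  shows "irreducible_rep Gr sc UNIV \<rho>"
proof -
  interpret V: finite_dimensional_vector_space sc B by fact
  interpret E: vector_space "fun_scale :: 'f alg_closure \<Rightarrow> ('v \<Rightarrow> 'f alg_closure) \<Rightarrow> _"
    by (rule vector_space_fun_scale)
  define D where "D x = (\<Sum>b\<in>B. sc (of_ac (x b)) b)" for x :: "'v \<Rightarrow> 'f alg_closure"
  define C where "C w = (\<lambda>b. to_ac (V.representation B w b))" for w
  have C_in: "C w \<in> ext_space B" for w
    using V.representation_ne_zero[of B w] by (auto simp: ext_space_def C_def)
  have rep: "(\<Sum>b\<in>B. sc (V.representation B w b) b) = w" for w
    by (rule V.sum_representation_eq) (simp_all add: V.independent_Basis V.span_Basis V.finite_Basis)
  have D_C: "D (C w) = w" for w by (simp add: D_def C_def rep)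
  have D_add: "D (x + y) = D x + D y" for x y
    by (simp add: D_def of_ac_add V.scale_left_distrib sum.distrib)
  have D_scale: "D (fun_scale c x) = sc (of_ac c) (D x)" for c x
    by (simp add: D_def fun_scale_def of_ac_mult V.scale_sum_right)
  have D_act: "D (ext_action sc B \<rho> g x) = \<rho> g (D x)" if g: "g \<in> carrier Gr" for g x
  proof -
    have "D (ext_action sc B \<rho> g x) = 
      (\<Sum>c\<in>B. \<Sum>b\<in>B. sc (V.representation B (\<rho> g b) c * of_ac (x b)) c)"
      by (simp add: D_def ext_action_def of_ac_sum of_ac_mult V.scale_sum_left)
    also have "\<dots> = (\<Sum>b\<in>B. sc (of_ac (x b)) (\<Sum>c\<in>B. sc (V.representation B (\<rho> g b) c) c))"
      by (subst sum.swap) (simp add: V.scale_sum_right mult.commute)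
    also have "\<dots> = \<rho> g (D x)"
      by (simp add: rep D_def linear_simps[OF lin[OF g]])
    finally show ?thesis .
  qed
  have act_in: "ext_action sc B \<rho> g x \<in> ext_space B" for g x
  proof -
    have "V.representation B w c = 0" if "c \<notin> B" for w c
      using V.representation_ne_zero[of B w c] that by blast
    thus ?thesis by (simp add: ext_space_def ext_action_def)
  qed
  have irr': "\<And>W. E.subspace W \<Longrightarrow> W \<subseteq> ext_space B \<Longrightarrow> 
      \<forall>g\<in>carrier Gr. ext_action sc B \<rho> g ` W \<subseteq> W \<Longrightarrow> W = {0} \<or> W = ext_space B"
    and ne: "ext_space B \<noteq> ({0} :: ('v \<Rightarrow> 'f alg_closure) set)"
    using irr unfolding absolutely_irreducible_rep_def irreducible_rep_def by blast+
  show ?thesis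
    unfolding irreducible_rep_def
  proof (intro conjI allI impI)
    have "(0 :: 'v \<Rightarrow> 'f alg_closure) \<in> ext_space B" by (simp add: ext_space_def)
    then obtain x :: "'v \<Rightarrow> 'f alg_closure" where x: "x \<in> ext_space B" "x \<noteq> 0"
      using ne by blast
    then obtain b where "x b \<noteq> 0" by (auto simp: fun_eq_iff)
    hence "b \<in> B" using x by (auto simp: ext_space_def)
    hence "b \<noteq> 0" using V.independent_Basis V.dependent_zero by blast
    thus "(UNIV :: 'v set) \<noteq> {0}" by blast
  next
    fix W assume W: "V.subspace W \<and> W \<subseteq> UNIV \<and> (\<forall>g\<in>carrier Gr. \<rho> g ` W \<subseteq> W)"
    define W' where "W' = {x \<in> ext_space B. D x \<in> W}"
    have "W' = {0} \<or> W' = ext_space B"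
    proof (rule irr')
      have D0: "D 0 = 0" by (simp add: D_def)
      show "E.subspace W'"
        unfolding E.subspace_def
        using W by (auto simp: W'_def ext_space_def D0 D_add D_scale V.subspace_0 V.subspace_add V.subspace_scale)
           (simp_all add: fun_scale_def)
      show "\<forall>g\<in>carrier Gr. ext_action sc B \<rho> g ` W' \<subseteq> W'"
      proof (intro ballI image_subsetI)
        fix g x assume g: "g \<in> carrier Gr" and x: "x \<in> W'"
        have "\<rho> g (D x) \<in> W" using W g x by (auto simp: W'_def)
        thus "ext_action sc B \<rho> g x \<in> W'" using g by (simp add: W'_def act_in D_act)
      qed
    qed (auto simp: W'_def)
    thus "W = {0} \<or> W = UNIV"
    proof
      assume W': "W' = {0}"
      have "w = 0" if "w \<in> W" for w
      proof -
        have "C w \<in> W'" using that by (simp add: W'_def C_in D_C)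
        hence "C w = 0" using W' by blast
        hence "D (C w) = 0" by (simp add: D_def)
        thus ?thesis by (simp add: D_C)
      qed
      thus ?thesis using W V.subspace_0 by blast
    next
      assume W': "W' = ext_space B"
      have "w \<in> W" for w
        using C_in[of w] unfolding W'[symmetric] by (simp add: W'_def D_C)
      thus ?thesis by blast
    qed
  qed
qed

section \<open>Representations with traces in the field of two elements\<close>

theorem theorem6p3:
  fixes k :: nat
    and sc :: "'f::alg_closed_field \<Rightarrow> 'v::ab_group_add \<Rightarrow> 'v"
    and B :: "'v set"
    and \<rho> :: "'q::{finite,field}^4^4 \<Rightarrow> 'v \<Rightarrow> 'v"
  assumes "k \<ge> 1"
    and "CARD('q) = 2 ^ (2 * k + 1)"
    and "algebraic_closure_of_F2 TYPE('f)"
    and "finite_dimensional_vector_space sc B"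
    and "\<rho> \<in> hom (suzuki_group k) (Aut sc)"
    and "inj_on \<rho> (carrier (suzuki_group k))"
    and "absolutely_irreducible_rep (suzuki_group k) sc B \<rho>"
    and "\<forall>g\<in>carrier (suzuki_group k). linear_trace sc B (\<rho> g) \<in> {0, 1}"
  shows "vector_space.dim sc (UNIV :: 'v set) = CARD('q) ^ 2 \<and>
    isomorphic_reps (suzuki_group k) sc UNIV \<rho>
      fun_scale (steinberg_space k) (steinberg_action k)"
proof -
  interpret V: finite_dimensional_vector_space sc B by fact
  have "irreducible_rep (suzuki_group k) sc UNIV \<rho>"
    using absolutely_irreducible_imp_irreducible[OF assms(4,7)] assms(5)
    by (auto simp: hom_def Aut_def Pi_def)
  hence irr: "\<And>W. V.subspace W \<Longrightarrow> (\<And>g x. g \<in> carrier (suzuki_group k) \<Longrightarrow> x \<in> W \<Longrightarrow> \<rho> g x \<in> W)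
      \<Longrightarrow> W = {0} \<or> W = UNIV"
    and "(UNIV :: 'v set) \<noteq> {0}"
    unfolding irreducible_rep_def by (blast, blast)
  hence ne: "\<exists>v::'v. v \<noteq> 0" by blast
  interpret suzuki_rep_F2 k "TYPE('q)" sc B \<rho>
    by unfold_locales (use assms irr ne in \<open>auto simp: algebraic_closure_of_F2_def\<close>)
  obtain v where v: "v \<noteq> 0" "\<And>p. p \<in> P \<Longrightarrow> \<rho> p v = v"
    using P_fixed_vector by blast
  interpret suzuki_rep_P_fixed k "TYPE('q)" sc B \<rho> v
    by unfold_locales (use v faithful in auto)
  show ?thesis using dim_eq isomorphic_steinberg by blast
qed

end
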